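(* Let $X_\iota$, $\iota\in I=\{1,2\}$, be bounded random variables which are free with respect to $\varphi$ (realized as in the context). Then, for each $\iota\in I$, the operator $X_{\bar\iota}X_\iota$ has the same $\varphi$-distribution as $Q_{\bar\iota}q_\iota$, where $q_\iota=1+x_\iota$ and $Q_{\bar\iota}=X_{\bar\iota}(X_\iota-x_\iota)$. Moreover, the pair $(q_\iota-1,\,Q_{\bar\iota}-1)$ is monotone independent with respect to $\varphi$. Finally, if $X_\iota$, $\iota\in I$, are unitary, then the operators $q_\iota,Q_\iota$, $\iota\in I$, are unitary.
   Context: $I=\{1,2\}$, $\bar 1=2$, $\bar 2=1$. $(\mathcal H_\iota,\xi_\iota)$, $\iota\in I$, are Hilbert spaces with distinguished unit vectors, $\mathcal H_\iota^0=\mathcal H_\iota\ominus\mathbb C\xi_\iota$. Their free product is $(\mathcal H,\xi)$, $\mathcal H=\mathbb C\xi\oplus\bigoplus_{n\ge1}\bigoplus_{\iota_1\ne\iota_2\ne\dots\ne\iota_n}\mathcal H_{\iota_1}^0\otimes\dots\otimes\mathcal H_{\iota_n}^0$. For $n\ge1$, $\mathcal H^{(n)}(\iota)$ is the direct sum of those $\mathcal H_{\iota_1}^0\otimes\dots\otimes\mathcal H_{\iota_n}^0$ ($\iota_1\neq\dots\neq\iota_n$) with $\iota_1\ne\iota$; $\mathcal H^{(0)}(\iota)=\mathbb C\xi$. For each $\iota$, $\mathcal H=\bigoplus_{n\ge1}\big(\mathcal H^{(n-1)}(\iota)\oplus\mathcal H^{(n)}(\bar\iota)\big)$ and $P_\iota(n)$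 is the orthogonal projection onto the $n$-th summand. $\lambda$ denotes the free product representation: $a\in B(\mathcal H_\iota)$ acts as $a\otimes1$ under the natural unitary $\mathcal H\cong\mathcal H_\iota\otimes\bigoplus_{n\ge0}\mathcal H^{(n)}(\iota)$. For fixed $x\in B(\mathcal H_1)$, $y\in B(\mathcal H_2)$ put $X_1=\lambda(x)$, $X_2=\lambda(y)$; these are free with respect to the vacuum state $\varphi(\cdot)=\langle\cdot\,\xi,\xi\rangle$ on $B(\mathcal H)$. Put $X_\iota(j)=P_\iota(j)X_\iota P_\iota(j)$ (so $X_\iota=\sum_jX_\iota(j)$ strongly), $x_\iota(j)=X_\iota(j)-P_\iota(j)$ and $x_\iota=x_\iota(1)$. The $\varphi$-distribution of $a$ is the functional $X^n\mapsto\varphi(a^n)$ on $\mathbb C[X]$. A pair $(a,b)$ is monotone independent w.r.t. $\varphi$ if, with $\mathcal A_1,\mathcal A_2$ the non-unital algebras generated by $a$ and by $b$, one has $\varphi(w_1a_1b')=\varphi(b')\varphi(w_1a_1)$, $\varphi(b'a_2w_2)=\varphi(b')\varphi(a_2w_2)$, $\varphi(w_1a_1b'a_2w_2)=\varphi(b')\varphi(w_1a_1a_2w_2)$ for all $a_1,a_2\in\mathcal A_1$, $b'\in\mathcal A_2$ and $w_1,w_2$ in the unital algebra generated by $\mathcal A_1,\mathcal A_2$. *)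

theory Defs
  imports "HOL-Analysis.Analysis" "HOL-Computational_Algebra.Polynomial"
begin

section \<open>Complex Hilbert spaces\<close>

text \<open>
  Complex inner product spaces are built on top of the real ones: the real inner product (hence
  the norm and the topology) is the real part of the complex one.  Positive definiteness of
  \<open>cinner\<close> is inherited in this way.  \<open>cinner\<close> is linear in its first argument.
\<close>

class complex_inner = real_inner +
  fixes scaleC :: "complex \<Rightarrow> 'a \<Rightarrow> 'a" (infixr "*\<^sub>C" 75)
    and cinner :: "'a \<Rightarrow> 'a \<Rightarrow> complex"
  assumes scaleC_add_right: "a *\<^sub>C (u + v) = a *\<^sub>C u + a *\<^sub>C v"
    and scaleC_add_left: "(a + b) *\<^sub>C u = a *\<^sub>C u + b *\<^sub>C u"
    and scaleC_scaleC: "a *\<^sub>C (b *\<^sub>C u) = (a * b) *\<^sub>C u"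
    and scaleR_scaleC: "r *\<^sub>R u = complex_of_real r *\<^sub>C u"
    and cinner_commute: "cinner u v = cnj (cinner v u)"
    and cinner_add_left: "cinner (u + v) w = cinner u w + cinner v w"
    and cinner_scaleC_left: "cinner (a *\<^sub>C u) v = a * cinner u v"
    and inner_eq_Re_cinner: "inner u v = Re (cinner u v)"

class chilbert_space = complex_inner + complete_space

instantiation complex :: chilbert_space
begin

definition scaleC_complex :: "complex \<Rightarrow> complex \<Rightarrow> complex"
  where "scaleC_complex a u = a * u"

definition cinner_complex :: "complex \<Rightarrow> complex \<Rightarrow> complex"
  where "cinner_complex u v = u * cnj v"

instance
  by standard
    (simp_all add: scaleC_complex_def cinner_complex_def algebra_simps scaleR_conv_of_real
      inner_complex_def)

end

global_interpretation complex_vector: vector_space "scaleC :: complex \<Rightarrow> 'a \<Rightarrow> 'a::complex_inner"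
proof
  show "1 *\<^sub>C u = u" for u :: 'a
    using scaleR_scaleC[of 1 u] by simp
qed (simp_all add: scaleC_add_right scaleC_add_left scaleC_scaleC)

definition bounded_clinear :: "('a::complex_inner \<Rightarrow> 'b::complex_inner) \<Rightarrow> bool"
  where "bounded_clinear f \<longleftrightarrow> bounded_linear f \<and> (\<forall>c u. f (c *\<^sub>C u) = c *\<^sub>C f u)"

definition is_adjoint :: "('a::complex_inner \<Rightarrow> 'a) \<Rightarrow> ('a \<Rightarrow> 'a) \<Rightarrow> bool"
  where "is_adjoint f g \<longleftrightarrow> (\<forall>u v. cinner (f u) v = cinner u (g v))"

definition unitary_op :: "('a::complex_inner \<Rightarrow> 'a) \<Rightarrow> bool"
  where "unitary_op f \<longleftrightarrow>
    bounded_clinear f \<and> (\<exists>g. is_adjoint f g \<and> g \<circ> f = id \<and> f \<circ> g = id)"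

text \<open>Orthogonal projection onto a closed complex subspace \<open>S\<close> of a Hilbert space.\<close>

definition orth_proj :: "'a::complex_inner set \<Rightarrow> 'a \<Rightarrow> 'a"
  where "orth_proj S v = (THE u. u \<in> S \<and> (\<forall>z\<in>S. cinner (v - u) z = 0))"


section \<open>Distributions and monotone independence\<close>

definition vector_state :: "'h::complex_inner \<Rightarrow> ('h \<Rightarrow> 'h) \<Rightarrow> complex"
  where "vector_state \<xi> a = cinner (a \<xi>) \<xi>"

text \<open>The linear functional on \<open>\<complex>[X]\<close> which sends \<open>X\<^sup>n\<close> to \<open>\<phi> (a\<^sup>n)\<close>.\<close>

definition distribution :: "(('h \<Rightarrow> 'h) \<Rightarrow> complex) \<Rightarrow> ('h \<Rightarrow> 'h) \<Rightarrow> complex poly \<Rightarrow> complex"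
  where "distribution \<phi> a p = (\<Sum>n\<le>degree p. coeff p n * \<phi> (a ^^ n))"

text \<open>
  The non-unital complex algebra of operators generated by \<open>S\<close>; the unital one is obtained by
  adding \<open>id\<close> to the generators.
\<close>

inductive_set gen_alg :: "('h::complex_inner \<Rightarrow> 'h) set \<Rightarrow> ('h \<Rightarrow> 'h) set"
  for S :: "('h \<Rightarrow> 'h) set"
where
  zero: "(\<lambda>_. 0) \<in> gen_alg S"
| gen: "a \<in> S \<Longrightarrow> a \<in> gen_alg S"
| add: "a \<in> gen_alg S \<Longrightarrow> b \<in> gen_alg S \<Longrightarrow> (\<lambda>v. a v + b v) \<in> gen_alg S"
| scale: "a \<in> gen_alg S \<Longrightarrow> (\<lambda>v. c *\<^sub>C a v) \<in> gen_alg S"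
| mult: "a \<in> gen_alg S \<Longrightarrow> b \<in> gen_alg S \<Longrightarrow> a \<circ> b \<in> gen_alg S"

definition monotone_independent ::
    "(('h::complex_inner \<Rightarrow> 'h) \<Rightarrow> complex) \<Rightarrow> ('h \<Rightarrow> 'h) \<Rightarrow> ('h \<Rightarrow> 'h) \<Rightarrow> bool"
  where "monotone_independent \<phi> a b \<longleftrightarrow>
    (\<forall>a1 \<in> gen_alg {a}. \<forall>a2 \<in> gen_alg {a}. \<forall>b' \<in> gen_alg {b}.
     \<forall>w1 \<in> gen_alg (insert id (gen_alg {a} \<union> gen_alg {b})).
     \<forall>w2 \<in> gen_alg (insert id (gen_alg {a} \<union> gen_alg {b})).
       \<phi> (w1 \<circ> a1 \<circ> b') = \<phi> b' * \<phi> (w1 \<circ> a1) \<and>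
       \<phi> (b' \<circ> a2 \<circ> w2) = \<phi> b' * \<phi> (a2 \<circ> w2) \<and>
       \<phi> (w1 \<circ> a1 \<circ> b' \<circ> a2 \<circ> w2) = \<phi> b' * \<phi> (w1 \<circ> a1 \<circ> a2 \<circ> w2))"


section \<open>The free product of two Hilbert spaces with distinguished unit vectors\<close>

datatype idx = I1 | I2

fun bar :: "idx \<Rightarrow> idx" where
  "bar I1 = I2"
| "bar I2 = I1"

text \<open>
  A word \<open>[z\<^sub>1, \<dots>, z\<^sub>n]\<close> of vectors, each from one of the two given spaces, stands for the simple
  tensor \<open>z\<^sub>1 \<otimes> \<dots> \<otimes> z\<^sub>n\<close>; the empty word stands for the vacuum vector.
\<close>

fun side :: "'a + 'b \<Rightarrow> idx" where
  "side (Inl h) = I1"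
| "side (Inr k) = I2"

fun centred :: "'a::complex_inner \<Rightarrow> 'b::complex_inner \<Rightarrow> 'a + 'b \<Rightarrow> bool" where
  "centred \<xi>1 \<xi>2 (Inl h) \<longleftrightarrow> cinner h \<xi>1 = 0"
| "centred \<xi>1 \<xi>2 (Inr k) \<longleftrightarrow> cinner k \<xi>2 = 0"

definition reduced :: "'a::complex_inner \<Rightarrow> 'b::complex_inner \<Rightarrow> ('a + 'b) list \<Rightarrow> bool"
  where "reduced \<xi>1 \<xi>2 w \<longleftrightarrow> (\<forall>z \<in> set w. centred \<xi>1 \<xi>2 z) \<and> distinct_adj (map side w)"

text \<open>
  The inner product of simple tensors.  Letters from different spaces get inner product 0, so that
  tensors of different type \<open>(\<iota>\<^sub>1, \<dots>, \<iota>\<^sub>n)\<close> are orthogonal.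
\<close>

fun letter_cinner :: "'a::complex_inner + 'b::complex_inner \<Rightarrow> 'a + 'b \<Rightarrow> complex" where
  "letter_cinner (Inl h) (Inl h') = cinner h h'"
| "letter_cinner (Inr k) (Inr k') = cinner k k'"
| "letter_cinner (Inl h) (Inr k) = 0"
| "letter_cinner (Inr k) (Inl h) = 0"

definition word_cinner ::
    "('a::complex_inner + 'b::complex_inner) list \<Rightarrow> ('a + 'b) list \<Rightarrow> complex"
  where "word_cinner v w =
    (if length v = length w then prod_list (map2 letter_cinner v w) else 0)"

text \<open>
  The Hilbert space \<open>'h\<close>, with \<open>T\<close> mapping a reduced word to the corresponding simple tensor and
  with vacuum vector \<open>T []\<close>, is the free product of \<open>('a, \<xi>1)\<close> and \<open>('b, \<xi>2)\<close>: the Hilbert direct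
  sum of \<open>\<complex> \<xi>\<close> and of the Hilbert tensor products of the spaces \<open>\<xi>1\<^sup>\<bottom>\<close> and \<open>\<xi>2\<^sup>\<bottom>\<close> along alternating
  index words.  The two tensor axioms (product inner products, total set of simple tensors) determine
  \<open>('h, T)\<close> up to a unique unitary.  Multilinearity of \<open>T\<close> on reduced words of a fixed type
  follows from the first one.  The values of \<open>T\<close> on words which are not reduced are irrelevant.
\<close>

locale free_product =
  fixes \<xi>1 :: "'a::chilbert_space" and \<xi>2 :: "'b::chilbert_space"
    and T :: "('a + 'b) list \<Rightarrow> 'h::chilbert_space"
  assumes norm_xi1: "norm \<xi>1 = 1"
    and norm_xi2: "norm \<xi>2 = 1"
    and cinner_tensor:
      "reduced \<xi>1 \<xi>2 v \<Longrightarrow> reduced \<xi>1 \<xi>2 w \<Longrightarrow> cinner (T v) (T w) = word_cinner v w"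
    and total_tensor: "closure (complex_vector.span (T ` {w. reduced \<xi>1 \<xi>2 w})) = UNIV"

text \<open>
  \<open>tensor_space \<xi>1 \<xi>2 T n \<iota>\<close> is the space \<open>\<H>\<^sup>(\<^sup>n\<^sup>)(\<iota>)\<close>: tensors of length \<open>n\<close> whose first factor is
  not from the \<open>\<iota>\<close>-th space.
\<close>

definition tensor_space ::
    "'a::complex_inner \<Rightarrow> 'b::complex_inner \<Rightarrow> (('a + 'b) list \<Rightarrow> 'h::complex_inner) \<Rightarrow>
      nat \<Rightarrow> idx \<Rightarrow> 'h set"
  where "tensor_space \<xi>1 \<xi>2 T n \<iota> =
    closure (complex_vector.span
      (T ` {w. reduced \<xi>1 \<xi>2 w \<and> length w = n \<and> (w \<noteq> [] \<longrightarrow> side (hd w) \<noteq> \<iota>)}))"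

text \<open>The projection \<open>P\<^sub>\<iota>(n)\<close>; meant for \<open>n \<ge> 1\<close> only.\<close>

definition block_proj ::
    "'a::complex_inner \<Rightarrow> 'b::complex_inner \<Rightarrow> (('a + 'b) list \<Rightarrow> 'h::complex_inner) \<Rightarrow>
      idx \<Rightarrow> nat \<Rightarrow> 'h \<Rightarrow> 'h"
  where "block_proj \<xi>1 \<xi>2 T \<iota> n =
    orth_proj {u + v | u v. u \<in> tensor_space \<xi>1 \<xi>2 T (n - 1) \<iota> \<and>
                            v \<in> tensor_space \<xi>1 \<xi>2 T n (bar \<iota>)}"

text \<open>
  Let \<open>emb\<close> be \<open>Inl\<close> or \<open>Inr\<close>, and let \<open>\<xi>0\<close> be the distinguished vector of the respective space.
  The natural unitary identifies \<open>\<H>\<close> with \<open>\<H>\<^sub>\<iota> \<otimes> (\<Oplus>n. \<H>\<^sup>(\<^sup>n\<^sup>)(\<iota>))\<close>; \<open>left_tensor\<close> is the vector of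
  \<open>\<H>\<close> that corresponds to \<open>h \<otimes> T w\<close>, where \<open>w\<close> is a reduced word not beginning in the \<open>\<iota>\<close>-th space:
  \<open>\<xi>0 \<otimes> T w\<close> corresponds to \<open>T w\<close>, and \<open>h \<otimes> T w\<close> to \<open>T (emb h # w)\<close> if \<open>h\<close> is orthogonal to \<open>\<xi>0\<close>.
\<close>

definition left_tensor ::
    "(('a + 'b) list \<Rightarrow> 'h::complex_inner) \<Rightarrow> ('c::complex_inner \<Rightarrow> 'a + 'b) \<Rightarrow> 'c \<Rightarrow>
      'c \<Rightarrow> ('a + 'b) list \<Rightarrow> 'h"
  where "left_tensor T emb \<xi>0 h w =
    cinner h \<xi>0 *\<^sub>C T w + T (emb (h - cinner h \<xi>0 *\<^sub>C \<xi>0) # w)"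

text \<open>The free product representation \<open>\<lambda>(a)\<close>: the bounded operator acting as \<open>a \<otimes> 1\<close>.\<close>

definition free_rep ::
    "'a::complex_inner \<Rightarrow> 'b::complex_inner \<Rightarrow> (('a + 'b) list \<Rightarrow> 'h::complex_inner) \<Rightarrow>
      ('c::complex_inner \<Rightarrow> 'a + 'b) \<Rightarrow> 'c \<Rightarrow> ('c \<Rightarrow> 'c) \<Rightarrow> 'h \<Rightarrow> 'h"
  where "free_rep \<xi>1 \<xi>2 T emb \<xi>0 a =
    (THE L. bounded_clinear L \<and>
      (\<forall>h w. reduced \<xi>1 \<xi>2 w \<and> (w \<noteq> [] \<longrightarrow> hd w \<notin> range emb) \<longrightarrow>
        L (left_tensor T emb \<xi>0 h w) = left_tensor T emb \<xi>0 (a h) w))"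

text \<open>\<open>free_pair \<xi>1 \<xi>2 T x y\<close> is the pair \<open>X\<^sub>1 = \<lambda>(x)\<close>, \<open>X\<^sub>2 = \<lambda>(y)\<close>.\<close>

fun free_pair ::
    "'a::complex_inner \<Rightarrow> 'b::complex_inner \<Rightarrow> (('a + 'b) list \<Rightarrow> 'h::complex_inner) \<Rightarrow>
      ('a \<Rightarrow> 'a) \<Rightarrow> ('b \<Rightarrow> 'b) \<Rightarrow> idx \<Rightarrow> 'h \<Rightarrow> 'h" where
  "free_pair \<xi>1 \<xi>2 T x y I1 = free_rep \<xi>1 \<xi>2 T Inl \<xi>1 x"
| "free_pair \<xi>1 \<xi>2 T x y I2 = free_rep \<xi>1 \<xi>2 T Inr \<xi>2 y"


section \<open>The operators built from the blocks\<close>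

text \<open>Here \<open>P \<iota> n\<close> stands for \<open>P\<^sub>\<iota>(n)\<close> and \<open>X \<iota>\<close> for \<open>X\<^sub>\<iota>\<close>.\<close>

definition block_part ::
    "(idx \<Rightarrow> nat \<Rightarrow> 'h \<Rightarrow> 'h) \<Rightarrow> (idx \<Rightarrow> 'h \<Rightarrow> 'h) \<Rightarrow> idx \<Rightarrow> nat \<Rightarrow> 'h \<Rightarrow> 'h"
  where "block_part P X \<iota> j = P \<iota> j \<circ> X \<iota> \<circ> P \<iota> j"

definition block_diff ::
    "(idx \<Rightarrow> nat \<Rightarrow> 'h \<Rightarrow> 'h::complex_inner) \<Rightarrow> (idx \<Rightarrow> 'h \<Rightarrow> 'h) \<Rightarrow> idx \<Rightarrow> nat \<Rightarrow> 'h \<Rightarrow> 'h"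
  where "block_diff P X \<iota> j = (\<lambda>v. block_part P X \<iota> j v - P \<iota> j v)"

definition op_q ::
    "(idx \<Rightarrow> nat \<Rightarrow> 'h \<Rightarrow> 'h::complex_inner) \<Rightarrow> (idx \<Rightarrow> 'h \<Rightarrow> 'h) \<Rightarrow> idx \<Rightarrow> 'h \<Rightarrow> 'h"
  where "op_q P X \<iota> = (\<lambda>v. v + block_diff P X \<iota> 1 v)"

text \<open>\<open>Q\<^sub>\<kappa> = X\<^sub>\<kappa> (X\<^sub>\<iota> - x\<^sub>\<iota>)\<close>, where \<open>\<iota>\<close> is the index other than \<open>\<kappa>\<close>.\<close>

definition op_Q ::
    "(idx \<Rightarrow> nat \<Rightarrow> 'h \<Rightarrow> 'h::complex_inner) \<Rightarrow> (idx \<Rightarrow> 'h \<Rightarrow> 'h) \<Rightarrow> idx \<Rightarrow> 'h \<Rightarrow> 'h"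
  where "op_Q P X \<kappa> = X \<kappa> \<circ> (\<lambda>v. X (bar \<kappa>) v - block_diff P X (bar \<kappa>) 1 v)"

end

theory Submission
  imports Defs
begin

text \<open>
  Write \<open>P = P\<^sub>\<iota>(1)\<close> and \<open>\<kappa>\<close> for the other index.  Since \<open>P\<close> commutes with \<open>X\<^sub>\<iota>\<close>, the operators
  \<open>q\<^sub>\<iota> = X\<^sub>\<iota> P + (1 - P)\<close> and \<open>R = X\<^sub>\<iota> - x\<^sub>\<iota> = X\<^sub>\<iota> (1 - P) + P\<close> satisfy \<open>R q\<^sub>\<iota> = X\<^sub>\<iota>\<close>, hence
  \<open>X\<^sub>\<kappa> X\<^sub>\<iota> = Q\<^sub>\<kappa> q\<^sub>\<iota>\<close> already as operators.  The algebra generated by \<open>q\<^sub>\<iota> - 1\<close> lives in the corner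
  \<open>P B(\<H>) P\<close>.  Split off from \<open>\<H>\<close> a last tensor factor \<open>\<H>\<^sub>\<iota>\<close>: both \<open>X\<^sub>\<kappa>\<close> and \<open>R\<close> act trivially on it, while
  \<open>P\<close> is the rank one projection onto the vacuum tensored with the identity of \<open>\<H>\<^sub>\<iota>\<close>.  Therefore
  \<open>P b P = \<phi>(b) P\<close> for every \<open>b\<close> in the algebra generated by \<open>Q\<^sub>\<kappa> - 1\<close>, which is monotone
  independence.
\<close>

section \<open>Complex inner product spaces\<close>

lemma cinner_add_right: "cinner u (v + w) = cinner u v + cinner u w"
  by (metis cinner_add_left cinner_commute complex_cnj_add)

lemma cinner_scaleC_right: "cinner u (c *\<^sub>C v) = cnj c * cinner u v"
  by (metis cinner_commute cinner_scaleC_left complex_cnj_mult)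

lemma scaleC_minus_one: "(-1) *\<^sub>C u = - (u :: 'a::complex_inner)"
  using complex_vector.scale_minus_left[of 1 u] by simp

lemma cinner_minus_left: "cinner (- u) v = - cinner u v"
  using cinner_scaleC_left[of "-1" u v] by (simp add: scaleC_minus_one)

lemma cinner_minus_right: "cinner u (- v) = - cinner u v"
  using cinner_scaleC_right[of u "-1" v] by (simp add: scaleC_minus_one)

lemma cinner_diff_left: "cinner (u - v) w = cinner u w - cinner v w"
  using cinner_add_left[of u "- v" w] by (simp add: cinner_minus_left)

lemma cinner_diff_right: "cinner u (v - w) = cinner u v - cinner u w"
  using cinner_add_right[of u v "- w"] by (simp add: cinner_minus_right)

lemma cinner_zero_left [simp]: "cinner 0 u = 0"
  using cinner_diff_left[of 0 0 u] by simp

lemma cinner_zero_right [simp]: "cinner u 0 = 0"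
  using cinner_diff_right[of u 0 0] by simp

lemma cinner_sum_left: "cinner (\<Sum>i\<in>F. f i) v = (\<Sum>i\<in>F. cinner (f i) v)"
  by (induction F rule: infinite_finite_induct) (auto simp: cinner_add_left)

lemma cinner_sum_right: "cinner u (\<Sum>i\<in>F. f i) = (\<Sum>i\<in>F. cinner u (f i))"
  by (induction F rule: infinite_finite_induct) (auto simp: cinner_add_right)

lemma cinner_self: "cinner u u = complex_of_real ((norm u)\<^sup>2)"
proof -
  have "Im (cinner u u) = 0"
    using arg_cong[OF cinner_commute[of u u], of Im] by simp
  moreover have "Re (cinner u u) = (norm u)\<^sup>2"
    by (metis inner_eq_Re_cinner power2_norm_eq_inner)
  ultimately show ?thesis by (simp add: complex_eq_iff)
qed

lemma cinner_self_eq_0_iff [simp]: "cinner u u = 0 \<longleftrightarrow> u = 0"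
  by (simp add: cinner_self)

lemma cinner_eq_0_commute: "cinner u v = 0 \<longleftrightarrow> cinner v u = 0"
  by (metis cinner_commute complex_cnj_zero)

lemma norm_scaleC: "norm (c *\<^sub>C u) = cmod c * norm (u :: 'a::complex_inner)"
proof (rule power2_eq_imp_eq)
  have "cinner (c *\<^sub>C u) (c *\<^sub>C u) = (c * cnj c) * cinner u u"
    by (simp add: cinner_scaleC_left cinner_scaleC_right)
  then have "complex_of_real ((norm (c *\<^sub>C u))\<^sup>2) = complex_of_real ((cmod c * norm u)\<^sup>2)"
    unfolding cinner_self by (simp add: power_mult_distrib flip: complex_norm_square)
  then show "(norm (c *\<^sub>C u))\<^sup>2 = (cmod c * norm u)\<^sup>2"
    using of_real_eq_iff by blast
qed auto

lemma norm_cinner_le: "cmod (cinner u v) \<le> norm u * norm v"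
proof (cases "cinner u v = 0")
  case False
  \<comment> \<open>The phase that turns \<open>cinner u v\<close> into its modulus, so that the
    real Cauchy-Schwarz inequality applies to \<open>c *\<^sub>C u\<close>.\<close>
  define c where "c = cnj (sgn (cinner u v))"
  have "cmod (cinner u v) = Re (cinner (c *\<^sub>C u) v)"
    using False by (simp add: cinner_scaleC_left c_def sgn_eq power2_eq_square mult.commute[of "cnj _"]
        flip: complex_norm_square)
  also have "\<dots> \<le> norm (c *\<^sub>C u) * norm v"
    by (metis Cauchy_Schwarz_ineq2 abs_le_D1 inner_eq_Re_cinner)
  also have "norm (c *\<^sub>C u) = norm u"
    using False by (simp add: norm_scaleC c_def norm_sgn)
  finally show ?thesis .
qed auto

text \<open>Graphs of operators and other linear relations become subspaces of a product space, so
  the lemmas on spans and closures apply to them.\<close>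

instantiation prod :: (complex_inner, complex_inner) complex_inner
begin

definition scaleC_prod :: "complex \<Rightarrow> 'a \<times> 'b \<Rightarrow> 'a \<times> 'b"
  where "scaleC_prod c p = (c *\<^sub>C fst p, c *\<^sub>C snd p)"

definition cinner_prod :: "'a \<times> 'b \<Rightarrow> 'a \<times> 'b \<Rightarrow> complex"
  where "cinner_prod p p' = cinner (fst p) (fst p') + cinner (snd p) (snd p')"

instance
proof
  fix p p' :: "'a \<times> 'b"
  show "cinner p p' = cnj (cinner p' p)"
    using cinner_commute[of "fst p" "fst p'"] cinner_commute[of "snd p" "snd p'"]
    by (simp add: cinner_prod_def)
qed (auto simp: scaleC_prod_def cinner_prod_def scaleC_add_right scaleC_add_left scaleC_scaleC
    scaleR_scaleC cinner_add_left cinner_scaleC_left inner_eq_Re_cinner inner_prod_def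
    algebra_simps prod_eq_iff)

end

section \<open>Bounded complex linear maps\<close>

lemma bounded_clinearI:
  assumes "\<And>u v. f (u + v) = f u + f v" "\<And>c u. f (c *\<^sub>C u) = c *\<^sub>C f u"
    and "\<And>u. norm (f u) \<le> C * norm u"
  shows "bounded_clinear f"
proof -
  have "bounded_linear f"
    using assms by (intro bounded_linear_intro[where K = C]) (auto simp: scaleR_scaleC mult.commute)
  then show ?thesis using assms by (simp add: bounded_clinear_def)
qed

lemma bounded_clinear_bounded_linear: "bounded_clinear f \<Longrightarrow> bounded_linear f"
  by (simp add: bounded_clinear_def)

lemma bounded_clinear_scaleC: "bounded_clinear f \<Longrightarrow> f (c *\<^sub>C u) = c *\<^sub>C f u"
  by (simp add: bounded_clinear_def)

lemma bounded_clinear_add: "bounded_clinear f \<Longrightarrow> f (u + v) = f u + f v"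
  by (simp add: bounded_clinear_def linear_simps)

lemma bounded_clinear_diff: "bounded_clinear f \<Longrightarrow> f (u - v) = f u - f v"
  by (simp add: bounded_clinear_def linear_simps)

lemma bounded_clinear_zero: "bounded_clinear f \<Longrightarrow> f 0 = 0"
  by (simp add: bounded_clinear_def linear_simps)

lemma bounded_clinear_sum: "bounded_clinear f \<Longrightarrow> f (\<Sum>i\<in>F. g i) = (\<Sum>i\<in>F. f (g i))"
  by (induction F rule: infinite_finite_induct)
    (auto simp: bounded_clinear_add bounded_clinear_zero)

lemmas bounded_clinear_simps =
  bounded_clinear_scaleC bounded_clinear_add bounded_clinear_diff bounded_clinear_zero

lemma bounded_clinear_id: "bounded_clinear (\<lambda>u. u)"
  by (simp add: bounded_clinear_def bounded_linear_ident)

lemma bounded_clinear_const_zero: "bounded_clinear (\<lambda>u. 0)"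
  by (simp add: bounded_clinear_def)

lemma bounded_clinear_compose:
  "bounded_clinear f \<Longrightarrow> bounded_clinear g \<Longrightarrow> bounded_clinear (\<lambda>u. f (g u))"
  by (simp add: bounded_clinear_def bounded_linear_compose)

lemma bounded_clinear_plus:
  "bounded_clinear f \<Longrightarrow> bounded_clinear g \<Longrightarrow> bounded_clinear (\<lambda>u. f u + g u)"
  by (simp add: bounded_clinear_def bounded_linear_add scaleC_add_right)

lemma bounded_clinear_minus:
  "bounded_clinear f \<Longrightarrow> bounded_clinear g \<Longrightarrow> bounded_clinear (\<lambda>u. f u - g u)"
  by (simp add: bounded_clinear_def bounded_linear_sub complex_vector.scale_right_diff_distrib)

lemma bounded_clinear_scaled: "bounded_clinear (\<lambda>u. c *\<^sub>C u)"
  by (rule bounded_clinearI[where C = "cmod c"])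
    (auto simp: scaleC_add_right scaleC_scaleC mult.commute norm_scaleC)

lemma bounded_clinear_cinner: "bounded_clinear (\<lambda>u. cinner u v)"
  by (rule bounded_clinearI[where C = "norm v"])
    (auto simp: cinner_add_left cinner_scaleC_left scaleC_complex_def norm_cinner_le mult.commute)

lemma bounded_clinear_rank_one: "bounded_clinear (\<lambda>u. cinner u v *\<^sub>C w)"
proof (rule bounded_clinearI[where C = "norm v * norm w"])
  show "norm (cinner u v *\<^sub>C w) \<le> norm v * norm w * norm u" for u
    using mult_right_mono[OF norm_cinner_le[of u v], of "norm w"]
    by (simp add: norm_scaleC mult_ac)
qed (auto simp: cinner_add_left cinner_scaleC_left scaleC_add_left scaleC_scaleC)

lemma bounded_clinear_fst: "bounded_clinear fst"
  by (simp add: bounded_clinear_def bounded_linear_fst scaleC_prod_def)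

lemma bounded_clinear_snd: "bounded_clinear snd"
  by (simp add: bounded_clinear_def bounded_linear_snd scaleC_prod_def)

lemma bounded_clinear_Pair:
  "bounded_clinear f \<Longrightarrow> bounded_clinear g \<Longrightarrow> bounded_clinear (\<lambda>u. (f u, g u))"
  by (simp add: bounded_clinear_def bounded_linear_Pair scaleC_prod_def)

lemma bounded_clinear_map_prod:
  "bounded_clinear f \<Longrightarrow> bounded_clinear g \<Longrightarrow> bounded_clinear (\<lambda>p. (f (fst p), g (snd p)))"
  by (intro bounded_clinear_Pair bounded_clinear_compose[of f fst] bounded_clinear_compose[of g snd]
      bounded_clinear_fst bounded_clinear_snd)

lemma continuous_on_bounded_clinear: "bounded_clinear f \<Longrightarrow> continuous_on S f"
  by (simp add: bounded_clinear_def linear_continuous_on)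

section \<open>Closed linear spans\<close>

lemma complex_subspace_closure:
  fixes S :: "'a::complex_inner set"
  assumes "complex_vector.subspace S"
  shows "complex_vector.subspace (closure S)"
proof (rule complex_vector.subspaceI)
  show "0 \<in> closure S"
    using assms closure_subset complex_vector.subspace_0 by blast
next
  fix u v assume "u \<in> closure S" "v \<in> closure S"
  then obtain f g where fg: "\<And>n. f n \<in> S" "f \<longlonglongrightarrow> u" "\<And>n. g n \<in> S" "g \<longlonglongrightarrow> v"
    unfolding closure_sequential by blast
  then have "(\<lambda>n. f n + g n) \<longlonglongrightarrow> u + v" "\<And>n. f n + g n \<in> S"
    using assms by (auto intro: tendsto_add complex_vector.subspace_add)
  then show "u + v \<in> closure S"
    unfolding closure_sequential by (intro exI[of _ "\<lambda>n. f n + g n"]) blast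
next
  fix c and u :: 'a assume u: "u \<in> closure S"
  have "(\<lambda>v. c *\<^sub>C v) ` closure S \<subseteq> closure S"
    by (rule image_closure_subset[OF continuous_on_bounded_clinear[OF bounded_clinear_scaled]])
      (use assms closure_subset[of S] in \<open>auto intro: complex_vector.subspace_scale\<close>)
  then show "c *\<^sub>C u \<in> closure S" using u by blast
qed

lemma subspace_closure_span: "complex_vector.subspace (closure (complex_vector.span S))"
  by (simp add: complex_subspace_closure complex_vector.subspace_span)

lemma in_closure_span: "v \<in> S \<Longrightarrow> v \<in> closure (complex_vector.span S)"
  using closure_subset complex_vector.span_base by blast

lemma subspace_zero: "complex_vector.subspace {0 :: 'a::complex_inner}"
  by (simp add: complex_vector.subspace_single_0)

lemma closure_span_minimal:
  assumes "S \<subseteq> M" "complex_vector.subspace M" "closed M"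
  shows "closure (complex_vector.span S) \<subseteq> M"
  using assms by (simp add: closure_minimal complex_vector.span_minimal)

text \<open>The preimage of a closed subspace under a bounded linear map is again one. This is the
  density argument behind the later proofs that check generators only.\<close>

lemma bounded_clinear_closure_span:
  assumes f: "bounded_clinear f" and M: "complex_vector.subspace M" "closed M"
    and S: "\<And>s. s \<in> S \<Longrightarrow> f s \<in> M" and v: "v \<in> closure (complex_vector.span S)"
  shows "f v \<in> M"
proof -
  have "complex_vector.subspace (f -` M)"
    using f M(1) by (auto simp: complex_vector.subspace_def bounded_clinear_simps)
  moreover have "closed (f -` M)"
    using f M(2) by (intro closed_vimage continuous_on_bounded_clinear)
  ultimately show ?thesis
    using closure_span_minimal[of S "f -` M"] S v by blast
qed

lemma bounded_clinear_eq_on_closure_span: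
  assumes "bounded_clinear f" "bounded_clinear g"
    and "\<And>s. s \<in> S \<Longrightarrow> f s = g s" and "v \<in> closure (complex_vector.span S)"
  shows "f v = g v"
  using bounded_clinear_closure_span[OF bounded_clinear_minus[OF assms(1,2)] subspace_zero
      closed_singleton, of S v] assms(3,4)
  by simp

lemma orthogonal_closure_span:
  assumes "\<And>s. s \<in> S \<Longrightarrow> cinner u s = 0" and "v \<in> closure (complex_vector.span S)"
  shows "cinner u v = 0"
  using bounded_clinear_closure_span[OF bounded_clinear_cinner[of u] subspace_zero
      closed_singleton, of S v] assms
  by (simp add: cinner_eq_0_commute[of u])

section \<open>Extension of operators from dense subspaces\<close>

text \<open>The closure of the graph is single-valued by the norm bound, and total by completeness.\<close>

lemma bounded_clinear_extension:
  fixes \<Gamma> :: "('a::complex_inner \<times> 'b::chilbert_space) set"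
  assumes sub: "complex_vector.subspace \<Gamma>" and dense: "closure (fst ` \<Gamma>) = UNIV"
    and bound: "\<And>p. p \<in> \<Gamma> \<Longrightarrow> norm (snd p) \<le> C * norm (fst p)"
  shows "\<exists>L. bounded_clinear L \<and> (\<forall>p\<in>\<Gamma>. L (fst p) = snd p)"
proof -
  let ?G = "closure \<Gamma>"
  have subG: "complex_vector.subspace ?G"
    by (rule complex_subspace_closure[OF sub])
  have "closed {p :: 'a \<times> 'b. norm (snd p) \<le> C * norm (fst p)}"
    by (intro closed_Collect_le continuous_intros)
  then have boundG: "norm (snd p) \<le> C * norm (fst p)" if "p \<in> ?G" for p
    using closure_minimal[of \<Gamma> "{p. norm (snd p) \<le> C * norm (fst p)}"] bound that by blast
  have uniq: "v = v'" if "(u, v) \<in> ?G" "(u, v') \<in> ?G" for u v v'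
    using boundG[OF complex_vector.subspace_diff[OF subG that]] by simp
  have ex: "\<exists>v. (u, v) \<in> ?G" for u
  proof -
    obtain f where f: "\<And>n. f n \<in> fst ` \<Gamma>" "f \<longlonglongrightarrow> u"
      using dense closure_sequential by blast
    then have "\<forall>n. \<exists>p. p \<in> \<Gamma> \<and> fst p = f n" by (metis imageE)
    then obtain p where p: "\<And>n. p n \<in> \<Gamma>" "\<And>n. fst (p n) = f n" by metis
    have "Cauchy (\<lambda>n. snd (p n))"
      unfolding Cauchy_altdef2 dist_norm
    proof (intro allI impI)
      fix e :: real assume e: "e > 0"
      \<comment> \<open>\<open>C\<close> may be 0 or negative; a positive constant is needed to
        divide \<open>e\<close> by.\<close>
      define C' where "C' = \<bar>C\<bar> + 1"
      have C': "C' > 0" unfolding C'_def by linarith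
      have "Cauchy f" using f(2) LIMSEQ_imp_Cauchy by blast
      then obtain N where N: "\<forall>n\<ge>N. norm (f n - f N) < e / C'"
        unfolding Cauchy_altdef2 dist_norm using e C' by (meson divide_pos_pos)
      have "norm (snd (p n) - snd (p N)) < e" if "n \<ge> N" for n
      proof -
        have "norm (snd (p n) - snd (p N)) \<le> C * norm (f n - f N)"
          using bound[OF complex_vector.subspace_diff[OF sub p(1)[of n] p(1)[of N]]] p(2) by simp
        also have "\<dots> \<le> C' * norm (f n - f N)"
          by (rule mult_right_mono) (auto simp: C'_def)
        also have "\<dots> < e"
          using N that C' by (simp add: field_simps)
        finally show ?thesis .
      qed
      then show "\<exists>N. \<forall>n\<ge>N. norm (snd (p n) - snd (p N)) < e" by blast
    qed
    then obtain v where "(\<lambda>n. snd (p n)) \<longlonglongrightarrow> v"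
      using Cauchy_convergent convergent_def by blast
    then have "(\<lambda>n. (fst (p n), snd (p n))) \<longlonglongrightarrow> (u, v)"
      using f(2) p(2) by (intro tendsto_Pair) auto
    then have "p \<longlonglongrightarrow> (u, v)" by simp
    then show ?thesis using p(1) closure_sequential by blast
  qed
  define L where "L u = (SOME v. (u, v) \<in> ?G)" for u
  have L: "(u, L u) \<in> ?G" for u
    unfolding L_def using ex by (rule someI_ex)
  have "bounded_clinear L"
  proof (rule bounded_clinearI[where C = C])
    show "L (u + v) = L u + L v" for u v
      using uniq[OF L[of "u + v"]] complex_vector.subspace_add[OF subG L[of u] L[of v]] by simp
    show "L (c *\<^sub>C u) = c *\<^sub>C L u" for c u
      using uniq[OF L[of "c *\<^sub>C u"]] complex_vector.subspace_scale[OF subG L[of u], of c]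
      by (simp add: scaleC_prod_def)
    show "norm (L u) \<le> C * norm u" for u
      using boundG[OF L[of u]] by simp
  qed
  moreover have "L (fst p) = snd p" if "p \<in> \<Gamma>" for p
    using uniq[OF L[of "fst p"]] that closure_subset[of \<Gamma>] by (metis prod.collapse subsetD)
  ultimately show ?thesis by blast
qed

text \<open>The bound holds for all coefficient families, so linear relations among the
  \<open>f i\<close> pass to the \<open>g i\<close>: the span of the pairs \<open>(f i, g i)\<close>
  is the graph of a bounded operator.\<close>

lemma bounded_clinear_extension_family:
  fixes f :: "'i \<Rightarrow> 'a::complex_inner" and g :: "'i \<Rightarrow> 'b::chilbert_space"
  assumes dense: "closure (complex_vector.span (f ` I)) = UNIV"
    and bound: "\<And>F c. finite F \<Longrightarrow> F \<subseteq> I \<Longrightarrow>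
      norm (\<Sum>i\<in>F. c i *\<^sub>C g i) \<le> C * norm (\<Sum>i\<in>F. c i *\<^sub>C f i)"
  shows "\<exists>L. bounded_clinear L \<and> (\<forall>i\<in>I. L (f i) = g i)"
proof -
  define \<Gamma> where "\<Gamma> = complex_vector.span ((\<lambda>i. (f i, g i)) ` I)"
  have sub: "complex_vector.subspace \<Gamma>"
    unfolding \<Gamma>_def by (rule complex_vector.subspace_span)
  have base: "(f i, g i) \<in> \<Gamma>" if "i \<in> I" for i
    unfolding \<Gamma>_def using that by (auto intro: complex_vector.span_base)
  have "complex_vector.subspace (fst ` \<Gamma>)"
  proof (rule complex_vector.subspaceI)
    show "0 \<in> fst ` \<Gamma>"
      using complex_vector.subspace_0[OF sub] by (metis fst_zero image_eqI)
    fix u v assume "u \<in> fst ` \<Gamma>" "v \<in> fst ` \<Gamma>"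
    then obtain p p' where p: "p \<in> \<Gamma>" "p' \<in> \<Gamma>" "u = fst p" "v = fst p'" by blast
    then have "u + v = fst (p + p')" by simp
    then show "u + v \<in> fst ` \<Gamma>"
      using complex_vector.subspace_add[OF sub p(1,2)] by (rule image_eqI)
  next
    fix c u assume "u \<in> fst ` \<Gamma>"
    then obtain p where p: "p \<in> \<Gamma>" "u = fst p" by blast
    then have "c *\<^sub>C u = fst (c *\<^sub>C p)" by (simp add: scaleC_prod_def)
    then show "c *\<^sub>C u \<in> fst ` \<Gamma>"
      using complex_vector.subspace_scale[OF sub p(1)] by (rule image_eqI)
  qed
  moreover have "f ` I \<subseteq> fst ` \<Gamma>"
    using base by force
  ultimately have "closure (fst ` \<Gamma>) = UNIV"
    using closure_mono[OF complex_vector.span_minimal, of "f ` I" "fst ` \<Gamma>"] dense by auto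
  moreover have "norm (snd p) \<le> C * norm (fst p)" if p_in: "p \<in> \<Gamma>" for p
  proof -
    have "p \<in> {\<Sum>a\<in>t. r a *\<^sub>C a |t r. finite t \<and> t \<subseteq> (\<lambda>i. (f i, g i)) ` I}"
      using p_in by (simp only: \<Gamma>_def complex_vector.span_explicit)
    then obtain t r where t: "finite t" "t \<subseteq> (\<lambda>i. (f i, g i)) ` I" "p = (\<Sum>a\<in>t. r a *\<^sub>C a)"
      by (elim CollectE exE conjE)
    \<comment> \<open>Different indices can give the same pair; thinning them out makes the sum over
      \<open>t\<close> a sum over indices.\<close>
    obtain F where F: "F \<subseteq> I" "inj_on (\<lambda>i. (f i, g i)) F" "t = (\<lambda>i. (f i, g i)) ` F"
      using subset_image_inj[THEN iffD1, OF t(2)] by (elim exE conjE)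
    define c where "c i = r (f i, g i)" for i
    have "finite F" using finite_imageD[OF _ F(2)] t(1) F(3) by simp
    moreover have p: "p = (\<Sum>i\<in>F. c i *\<^sub>C (f i, g i))"
      using t(3) F(2,3) by (simp add: sum.reindex c_def)
    have "fst p = (\<Sum>i\<in>F. c i *\<^sub>C f i)" "snd p = (\<Sum>i\<in>F. c i *\<^sub>C g i)"
      unfolding p by (simp_all add: fst_sum snd_sum scaleC_prod_def)
    ultimately show ?thesis using bound F(1) by simp
  qed
  ultimately obtain L where L: "bounded_clinear L" "\<forall>p\<in>\<Gamma>. L (fst p) = snd p"
    using bounded_clinear_extension[OF sub, of C] by blast
  have "L (f i) = g i" if "i \<in> I" for i
    using bspec[OF L(2) base[OF that]] by simp
  then show ?thesis using L(1) by blast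
qed

section \<open>The norm bound for \<open>a \<otimes> 1\<close>\<close>

text \<open>The double sum is the squared norm of the algebraic tensor
  \<open>\<Sum>i. g i \<otimes> u i\<close>. Each \<open>u i\<close> is its part
  \<open>\<alpha> i *\<^sub>C u k\<close> along \<open>u k\<close> plus the orthogonal rest
  \<open>u' i\<close>; the parts along \<open>u k\<close> add up to the simple tensor of
  \<open>\<Sum>i. \<alpha> i *\<^sub>C g i\<close> and \<open>u k\<close>, and Pythagoras separates
  it.\<close>

lemma sum_cinner_tensor_split:
  fixes u :: "'i \<Rightarrow> 'h::complex_inner" and g :: "'i \<Rightarrow> 'c::complex_inner"
  assumes F: "finite F" "k \<notin> F"
    and \<alpha>: "\<And>i. \<alpha> i = cinner (u i) (u k) / complex_of_real ((norm (u k))\<^sup>2)"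
    and u': "\<And>i. u' i = u i - \<alpha> i *\<^sub>C u k"
  shows "(\<Sum>i\<in>insert k F. \<Sum>j\<in>insert k F. cinner (g i) (g j) * cinner (u i) (u j)) =
    (\<Sum>i\<in>F. \<Sum>j\<in>F. cinner (g i) (g j) * cinner (u' i) (u' j)) +
    complex_of_real ((norm (u k) * norm (\<Sum>i\<in>insert k F. \<alpha> i *\<^sub>C g i))\<^sup>2)"
proof -
  let ?n = "complex_of_real ((norm (u k))\<^sup>2)"
  have n: "cinner (u k) (u k) = ?n" by (rule cinner_self)
  \<comment> \<open>If \<open>u k = 0\<close>, division by zero makes all \<open>\<alpha> i\<close>
    zero, and orthogonality is trivial.\<close>
  have orth: "cinner (u' i) (u k) = 0" for i
    by (cases "u k = 0") (simp_all add: u' \<alpha> cinner_diff_left cinner_scaleC_left n)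
  then have orth': "cinner (u k) (u' i) = 0" for i by (simp add: cinner_eq_0_commute)
  have k: "u' k = 0"
    using n by (cases "u k = 0") (simp_all add: u' \<alpha>)
  have split: "cinner (u i) (u j) = cinner (u' i) (u' j) + \<alpha> i * cnj (\<alpha> j) * ?n" for i j
  proof -
    have ui: "u i = u' i + \<alpha> i *\<^sub>C u k" for i by (simp add: u')
    show ?thesis
      unfolding ui[of i] ui[of j]
      by (simp add: cinner_add_left cinner_add_right cinner_scaleC_left cinner_scaleC_right
          orth orth' n)
  qed
  let ?s = "\<Sum>i\<in>insert k F. \<alpha> i *\<^sub>C g i"
  have "complex_of_real ((norm (u k) * norm ?s)\<^sup>2) = ?n * cinner ?s ?s"
    by (simp add: cinner_self power_mult_distrib)
  also have "\<dots> = (\<Sum>i\<in>insert k F. \<Sum>j\<in>insert k F.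
      cinner (g i) (g j) * (\<alpha> i * cnj (\<alpha> j) * ?n))"
    by (subst sum.swap) (simp only: cinner_sum_left cinner_sum_right cinner_scaleC_left cinner_scaleC_right
        sum_distrib_left mult_ac)
  finally have s: "\<dots> = complex_of_real ((norm (u k) * norm ?s)\<^sup>2)" by simp
  have "(\<Sum>i\<in>insert k F. \<Sum>j\<in>insert k F. cinner (g i) (g j) * cinner (u' i) (u' j)) =
      (\<Sum>i\<in>F. \<Sum>j\<in>F. cinner (g i) (g j) * cinner (u' i) (u' j))"
    using F k by simp
  then show ?thesis
    unfolding split s[symmetric] by (simp only: distrib_left sum.distrib)
qed

text \<open>
  The bound \<open>\<parallel>a \<otimes> 1\<parallel> \<le> C\<close> on algebraic tensors \<open>\<Sum>i. g i \<otimes> u i\<close>.  The induction is the Gram-Schmidt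
  process: the component of all \<open>u i\<close> along one of them is split off.
\<close>

lemma tensor_identity_bound:
  fixes u :: "'i \<Rightarrow> 'h::complex_inner" and g :: "'i \<Rightarrow> 'c::complex_inner"
  assumes a: "bounded_clinear a" and C: "\<And>v. norm (a v) \<le> C * norm v" and "finite F"
  shows "Re (\<Sum>i\<in>F. \<Sum>j\<in>F. cinner (a (g i)) (a (g j)) * cinner (u i) (u j))
    \<le> C\<^sup>2 * Re (\<Sum>i\<in>F. \<Sum>j\<in>F. cinner (g i) (g j) * cinner (u i) (u j))"
  using \<open>finite F\<close>
proof (induction F arbitrary: u rule: finite_induct)
  case (insert k F)
  define \<alpha> where "\<alpha> i = cinner (u i) (u k) / complex_of_real ((norm (u k))\<^sup>2)" for i
  define u' where "u' i = u i - \<alpha> i *\<^sub>C u k" for i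
  let ?s = "\<Sum>i\<in>insert k F. \<alpha> i *\<^sub>C g i"
  have s: "(\<Sum>i\<in>insert k F. \<alpha> i *\<^sub>C a (g i)) = a ?s"
    by (simp only: bounded_clinear_sum[OF a] bounded_clinear_scaleC[OF a])
  have "norm (u k) * norm (a ?s) \<le> C * (norm (u k) * norm ?s)"
    using mult_left_mono[OF C[of ?s], of "norm (u k)"] by (simp add: mult_ac)
  then have "(norm (u k) * norm (a ?s))\<^sup>2 \<le> C\<^sup>2 * (norm (u k) * norm ?s)\<^sup>2"
    using power_mono[of "norm (u k) * norm (a ?s)" _ 2] by (fastforce simp: power_mult_distrib)
  then show ?case
    unfolding sum_cinner_tensor_split[of F k \<alpha> u u', OF insert.hyps \<alpha>_def u'_def] s
    using insert.IH[of u'] by (simp only: plus_complex.sel Re_complex_of_real distrib_left)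
qed simp

section \<open>Unitary operators\<close>

lemma unitary_op_compose:
  assumes "unitary_op f" "unitary_op g"
  shows "unitary_op (\<lambda>v. f (g v))"
proof -
  obtain f' g' where *: "is_adjoint f f'" "f' \<circ> f = id" "f \<circ> f' = id"
    "is_adjoint g g'" "g' \<circ> g = id" "g \<circ> g' = id"
    using assms unfolding unitary_op_def by blast
  then have "is_adjoint (\<lambda>v. f (g v)) (\<lambda>v. g' (f' v))"
    "(\<lambda>v. g' (f' v)) \<circ> (\<lambda>v. f (g v)) = id" "(\<lambda>v. f (g v)) \<circ> (\<lambda>v. g' (f' v)) = id"
    by (simp_all add: is_adjoint_def fun_eq_iff)
  moreover have "bounded_clinear (\<lambda>v. f (g v))"
    using assms by (simp add: unitary_op_def bounded_clinear_compose)
  ultimately show ?thesis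
    unfolding unitary_op_def by blast
qed

text \<open>\<open>f \<circ> g = id\<close> makes \<open>g\<close> isometric, as
  \<open>cinner (g v) (g v) = cinner (f (g v)) v\<close>; linearity holds because vectors are
  determined by their inner products.\<close>

lemma is_adjoint_bounded_clinear:
  assumes "is_adjoint f g" "f \<circ> g = id"
  shows "bounded_clinear g"
proof -
  have adj: "cinner (f u) v = cinner u (g v)" for u v
    using assms(1) by (simp add: is_adjoint_def)
  have eqI: "v = w" if "\<And>u. cinner u v = cinner u w" for v w :: 'a
    using that[of "v - w"] cinner_self_eq_0_iff[of "v - w"] by (simp add: cinner_diff_right)
  have "cinner (g v) (g v) = cinner v v" for v
    using adj[of "g v" v] assms(2) by (simp add: fun_eq_iff)
  then have "norm (g v) = norm v" for v
    by (metis inner_eq_Re_cinner norm_eq)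
  then show ?thesis
    by (intro bounded_clinearI[where C = 1] eqI)
      (simp_all add: cinner_add_right cinner_scaleC_right flip: adj)
qed

lemma unitary_op_inverse:
  assumes "is_adjoint f g" "g \<circ> f = id" "f \<circ> g = id"
  shows "unitary_op g"
proof -
  have "is_adjoint g f"
    unfolding is_adjoint_def
  proof (intro allI)
    show "cinner (g u) v = cinner u (f v)" for u v
      using assms(1) cinner_commute[of "g u" v] cinner_commute[of u "f v"]
      by (simp add: is_adjoint_def)
  qed
  then show ?thesis
    unfolding unitary_op_def using is_adjoint_bounded_clinear[OF assms(1,3)] assms(2,3) by blast
qed

section \<open>Reduced words\<close>

lemma bar_bar [simp]: "bar (bar \<iota>) = \<iota>"
  by (cases \<iota>) auto

lemma neq_bar_iff: "\<kappa> \<noteq> bar \<iota> \<longleftrightarrow> \<kappa> = \<iota>"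
  by (cases \<iota>; cases \<kappa>) auto

lemma reduced_Nil [simp]: "reduced \<xi>1 \<xi>2 []"
  by (simp add: reduced_def)

lemma reduced_Cons:
  "reduced \<xi>1 \<xi>2 (z # w) \<longleftrightarrow>
    centred \<xi>1 \<xi>2 z \<and> reduced \<xi>1 \<xi>2 w \<and> (w \<noteq> [] \<longrightarrow> side z \<noteq> side (hd w))"
  by (cases w) (auto simp: reduced_def)

lemma reduced_append:
  "reduced \<xi>1 \<xi>2 (v @ w) \<longleftrightarrow> reduced \<xi>1 \<xi>2 v \<and> reduced \<xi>1 \<xi>2 w \<and>
    (v \<noteq> [] \<longrightarrow> w \<noteq> [] \<longrightarrow> side (last v) \<noteq> side (hd w))"
  by (induction v) (auto simp: reduced_Cons)

lemma letter_cinner_eq_0: "side z \<noteq> side z' \<Longrightarrow> letter_cinner z z' = 0"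
  by (cases z; cases z') auto

lemma word_cinner_simps [simp]:
  "word_cinner [] [] = 1"
  "word_cinner [] (z # w) = 0"
  "word_cinner (z # w) [] = 0"
  "word_cinner (z # w) (z' # w') = letter_cinner z z' * word_cinner w w'"
  by (simp_all add: word_cinner_def)

context free_product
begin

abbreviation red :: "('a + 'b) list \<Rightarrow> bool"
  where "red \<equiv> reduced \<xi>1 \<xi>2"

lemma closure_span_tensors: "u \<in> closure (complex_vector.span (T ` {w. red w}))"
  using total_tensor by simp

lemma cinner_T_Nil: "red w \<Longrightarrow> cinner (T w) (T []) = (if w = [] then 1 else 0)"
  by (cases w) (simp_all add: cinner_tensor)

section \<open>Splitting off a last tensor factor\<close>

text \<open>
  The closed linear relation \<open>u \<mapsto> u \<otimes> T s\<close>, where \<open>u\<close> is spanned by tensors whose last factor is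
  not from the \<open>j\<close>-th space.  The operators \<open>X\<^sub>\<iota>\<close> act on the left, so they are compatible with it.
\<close>

definition right_tensor :: "idx \<Rightarrow> ('a + 'b) list \<Rightarrow> ('h \<times> 'h) set"
  where "right_tensor j s = closure (complex_vector.span
    ((\<lambda>w. (T w, T (w @ s))) ` {w. red w \<and> (w \<noteq> [] \<longrightarrow> side (last w) \<noteq> j)}))"

text \<open>The tensors of the reduced words of this kind have the range of
  \<open>P\<^sub>j(1)\<close> as closed span: a copy of \<open>\<H>\<^sub>j\<close> inside
  \<open>\<H>\<close>, vacuum included.\<close>

definition short :: "idx \<Rightarrow> ('a + 'b) list \<Rightarrow> bool"
  where "short j s \<longleftrightarrow> s = [] \<or> (\<exists>z. s = [z] \<and> side z = j)"

lemma right_tensorI: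
  "red w \<Longrightarrow> (w \<noteq> [] \<Longrightarrow> side (last w) \<noteq> j) \<Longrightarrow> (T w, T (w @ s)) \<in> right_tensor j s"
  unfolding right_tensor_def by (rule in_closure_span) auto

lemma subspace_right_tensor: "complex_vector.subspace (right_tensor j s)"
  unfolding right_tensor_def by (rule subspace_closure_span)

lemma closed_right_tensor: "closed (right_tensor j s)"
  by (simp add: right_tensor_def)

lemma right_tensor_induct:
  assumes "(u, v) \<in> right_tensor j s" and "bounded_clinear f" and "bounded_clinear g"
    and "\<And>w. red w \<Longrightarrow> (w \<noteq> [] \<Longrightarrow> side (last w) \<noteq> j) \<Longrightarrow>
      (f (T w), g (T (w @ s))) \<in> right_tensor j s"
  shows "(f u, g v) \<in> right_tensor j s"
proof -
  have "(f (fst q), g (snd q)) \<in> right_tensor j s"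
    if q: "q \<in> (\<lambda>w. (T w, T (w @ s))) ` {w. red w \<and> (w \<noteq> [] \<longrightarrow> side (last w) \<noteq> j)}" for q
  proof -
    obtain w where "red w" "w \<noteq> [] \<longrightarrow> side (last w) \<noteq> j" "q = (T w, T (w @ s))"
      using q by blast
    then show ?thesis using assms(4)[of w] by simp
  qed
  from bounded_clinear_closure_span[OF bounded_clinear_map_prod[OF assms(2,3)]
      subspace_right_tensor closed_right_tensor this assms(1)[unfolded right_tensor_def]]
  show ?thesis by simp
qed

section \<open>The projection \<open>P\<^sub>j(1)\<close>\<close>

lemma cinner_short_eq_0:
  "red v \<Longrightarrow> red w \<Longrightarrow> short j v \<Longrightarrow> \<not> short j w \<Longrightarrow> cinner (T v) (T w) = 0"
  unfolding short_def
  by (cases v; cases w; cases "tl w") (auto simp: cinner_tensor letter_cinner_eq_0)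

text \<open>In a finite sum of simple tensors the short terms are orthogonal to the others. By
  Pythagoras, discarding the others does not increase the norm, so the map extends to all of
  \<open>\<H>\<close>.\<close>

lemma short_projection_exists:
  "\<exists>E. bounded_clinear E \<and> (\<forall>w\<in>{w. red w}. E (T w) = (if short j w then T w else 0))"
proof (rule bounded_clinear_extension_family[where C = 1, OF total_tensor])
  fix F :: "('a + 'b) list set" and c
  assume F: "finite F" "F \<subseteq> {w. red w}"
  let ?A = "\<Sum>w\<in>F \<inter> {w. short j w}. c w *\<^sub>C T w"
  let ?B = "\<Sum>w\<in>F - {w. short j w}. c w *\<^sub>C T w"
  have "(\<Sum>w\<in>F. c w *\<^sub>C (if short j w then T w else 0)) =
      (\<Sum>w\<in>F. if w \<in> {w. short j w} then c w *\<^sub>C T w else 0)"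
    by (rule sum.cong) auto
  then have A: "(\<Sum>w\<in>F. c w *\<^sub>C (if short j w then T w else 0)) = ?A"
    by (simp only: sum.inter_restrict[OF F(1)])
  have AB: "(\<Sum>w\<in>F. c w *\<^sub>C T w) = ?A + ?B"
    by (rule sum.Int_Diff[OF F(1)])
  have "cinner (c v *\<^sub>C T v) (c w *\<^sub>C T w) = 0"
    if "v \<in> F \<inter> {w. short j w}" "w \<in> F - {w. short j w}" for v w
    using that F(2) cinner_short_eq_0[of v w j]
    by (simp add: cinner_scaleC_left cinner_scaleC_right subset_eq)
  then have "cinner ?A ?B = 0"
    unfolding cinner_sum_left cinner_sum_right by (intro sum.neutral ballI)
  then have "orthogonal ?A ?B"
    by (simp add: inner_eq_Re_cinner orthogonal_def)
  then have "(norm ?A)\<^sup>2 \<le> (norm (?A + ?B))\<^sup>2"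
    by (simp only: norm_add_Pythagorean le_add_same_cancel1 zero_le_power2)
  then have "norm ?A \<le> norm (?A + ?B)"
    by (rule power2_le_imp_le) (rule norm_ge_zero)
  then show "norm (\<Sum>w\<in>F. c w *\<^sub>C (if short j w then T w else 0)) \<le> 1 * norm (\<Sum>w\<in>F. c w *\<^sub>C T w)"
    unfolding A AB by simp
qed

text \<open>The definite description in \<open>orth_proj\<close> is resolved by showing that
  \<open>E\<close> maps into the subspace and that \<open>u - E u\<close> is orthogonal to
  it.\<close>

lemma block_proj_short:
  assumes E: "bounded_clinear E" and ET: "\<And>w. red w \<Longrightarrow> E (T w) = (if short j w then T w else 0)"
  shows "block_proj \<xi>1 \<xi>2 T j 1 = E"
    and "cinner (u - E u) (E v) = 0"
proof -
  \<comment> \<open>For block 1 the lengths are 0 and 1. The argument \<open>bar j\<close> excludes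
    first letters from the space of index \<open>bar j\<close>, so the single letter is from the
    \<open>j\<close>-th one.\<close>
  let ?Ka = "tensor_space \<xi>1 \<xi>2 T 0 j" and ?Kb = "tensor_space \<xi>1 \<xi>2 T 1 (bar j)"
  let ?K = "{u + v | u v. u \<in> ?Ka \<and> v \<in> ?Kb}"
  have K0: "?Ka = closure (complex_vector.span {T []})"
  proof -
    have "{w. red w \<and> length w = 0 \<and> (w \<noteq> [] \<longrightarrow> side (hd w) \<noteq> j)} = {[]}" by auto
    then show ?thesis by (simp add: tensor_space_def)
  qed
  have orth: "cinner (u - E u) (T w) = 0" if w: "red w" "short j w" for u w
  proof -
    have "cinner (T v - E (T v)) (T w) = 0" if "red v" for v
      using cinner_short_eq_0[OF w(1) that w(2)] that
      by (simp add: ET cinner_eq_0_commute[of _ "T w"])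
    moreover have "bounded_clinear (\<lambda>u. cinner (u - E u) (T w))"
      by (rule bounded_clinear_compose[OF bounded_clinear_cinner
            bounded_clinear_minus[OF bounded_clinear_id E]])
    ultimately have "cinner (u - E u) (T w) \<in> {0}"
      using bounded_clinear_closure_span[OF _ subspace_zero closed_singleton _
          closure_span_tensors, of "\<lambda>u. cinner (u - E u) (T w)" u]
      by blast
    then show ?thesis by simp
  qed
  have orthK0: "cinner (u - E u) z = 0" if "z \<in> ?Ka" for u z
    using that unfolding K0 by (rule orthogonal_closure_span[rotated]) (auto intro: orth simp: short_def)
  have orthK1: "cinner (u - E u) z = 0" if "z \<in> ?Kb" for u z
    using that unfolding tensor_space_def
  proof (rule orthogonal_closure_span[rotated])
    fix s assume "s \<in> T ` {w. red w \<and> length w = 1 \<and> (w \<noteq> [] \<longrightarrow> side (hd w) \<noteq> bar j)}"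
    then show "cinner (u - E u) s = 0"
      by (auto simp: short_def length_Suc_conv neq_bar_iff intro!: orth)
  qed
  have orthK: "cinner (u - E u) z = 0" if "z \<in> ?K" for u z
    using that by (auto simp: cinner_add_right orthK0 orthK1)
  have EK: "E u \<in> ?K" for u
  proof -
    \<comment> \<open>The component along the vacuum goes to \<open>?Ka\<close>; what remains of
      \<open>E u\<close> is a limit of combinations of one-letter tensors and goes to
      \<open>?Kb\<close>.\<close>
    let ?c = "\<lambda>u. cinner (E u) (T []) *\<^sub>C T []"
    have "?c u \<in> ?Ka"
      unfolding K0 by (intro complex_vector.subspace_scale[OF subspace_closure_span]
          in_closure_span) simp
    moreover have "E u - ?c u \<in> ?Kb"
      unfolding tensor_space_def
    proof (rule bounded_clinear_closure_span[of "\<lambda>u. E u - ?c u",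
          OF _ subspace_closure_span closed_closure _ closure_span_tensors])
      show "bounded_clinear (\<lambda>u. E u - ?c u)"
        by (rule bounded_clinear_minus[OF E bounded_clinear_compose[OF bounded_clinear_rank_one E]])
      fix s assume "s \<in> T ` {w. red w}"
      then obtain w where w: "red w" "s = T w" by blast
      show "E s - ?c s \<in> closure (complex_vector.span
          (T ` {w. red w \<and> length w = 1 \<and> (w \<noteq> [] \<longrightarrow> side (hd w) \<noteq> bar j)}))"
      proof (cases "short j w \<and> w \<noteq> []")
        case True
        then have "E s - ?c s = T w"
          using w by (simp add: ET cinner_T_Nil)
        then show ?thesis
          using True w by (auto simp: short_def neq_bar_iff intro!: in_closure_span)
      next
        case False
        then have "E s - ?c s = 0"
          using w by (auto simp: ET cinner_T_Nil short_def)
        then show ?thesis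
          by (simp only: complex_vector.subspace_0[OF subspace_closure_span])
      qed
    qed
    ultimately show ?thesis
      by (intro CollectI exI[of _ "?c u"] exI[of _ "E u - ?c u"]) simp
  qed
  have "orth_proj ?K u = E u" for u
    unfolding orth_proj_def
  proof (rule the_equality)
    show "E u \<in> ?K \<and> (\<forall>z\<in>?K. cinner (u - E u) z = 0)"
      using EK orthK by blast
    fix u' assume u': "u' \<in> ?K \<and> (\<forall>z\<in>?K. cinner (u - u') z = 0)"
    have "cinner (E u - u') z = 0" if "z \<in> ?K" for z
    proof -
      have "E u - u' = (u - u') - (u - E u)" by simp
      then show ?thesis
        using u' orthK[OF that, of u] that by (simp only: cinner_diff_left[of "u - u'"]) simp
    qed
    then have "cinner (E u - u') (E u - u') = 0"
      using u' EK[of u] by (simp only: cinner_diff_right) simp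
    then show "u' = E u" by simp
  qed
  then show "block_proj \<xi>1 \<xi>2 T j 1 = E"
    by (auto simp: block_proj_def fun_eq_iff)
  show "cinner (u - E u) (E v) = 0"
    by (rule orthK[OF EK])
qed

definition head_proj :: "idx \<Rightarrow> 'h \<Rightarrow> 'h"
  where "head_proj j = block_proj \<xi>1 \<xi>2 T j 1"

lemma head_proj_props:
  shows bounded_clinear_head_proj: "bounded_clinear (head_proj j)"
    and head_proj_T: "red w \<Longrightarrow> head_proj j (T w) = (if short j w then T w else 0)"
    and head_proj_self_adjoint: "cinner (head_proj j u) v = cinner u (head_proj j v)"
proof -
  obtain E where E0: "bounded_clinear E"
      "\<forall>w\<in>{w. red w}. E (T w) = (if short j w then T w else 0)"
    using short_projection_exists[of j] by (elim exE conjE)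
  have E: "bounded_clinear E" "red w \<Longrightarrow> E (T w) = (if short j w then T w else 0)" for w
    using E0 by simp_all
  have p: "head_proj j = E" unfolding head_proj_def by (rule block_proj_short(1)[OF E])
  show "bounded_clinear (head_proj j)" "red w \<Longrightarrow> head_proj j (T w) = (if short j w then T w else 0)"
    unfolding p by (fact E)+
  have orth: "cinner (u - E u) (E v) = 0" for u v
    using block_proj_short(2)[OF E] .
  have "cinner (E u) (v - E v) = 0"
    using orth[of v u] by (simp only: cinner_eq_0_commute[of "E u"])
  then have "cinner (E u) v = cinner (E u) (E v)"
    by (simp add: cinner_diff_right)
  also have "\<dots> = cinner u (E v)"
    using orth[of u v] by (simp add: cinner_diff_left)
  finally show "cinner (head_proj j u) v = cinner u (head_proj j v)" unfolding p .
qed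

text \<open>Relative to the last factor, \<open>head_proj j\<close> is the vacuum projection
  tensored with the identity. On generators: a nonempty \<open>w\<close> does not end in the
  \<open>j\<close>-th space, so \<open>w @ s\<close> is not short and is killed; only
  \<open>w = []\<close> survives.\<close>

lemma head_proj_right_tensor:
  assumes uv: "(u, v) \<in> right_tensor j s" and s: "red s" "short j s"
  shows "head_proj j v = cinner u (T []) *\<^sub>C T s"
proof -
  let ?p = "head_proj j"
  have "?p (snd (u, v)) = cinner (fst (u, v)) (T []) *\<^sub>C T s"
  proof (rule bounded_clinear_eq_on_closure_span[OF _ _ _ uv[unfolded right_tensor_def]])
    show "bounded_clinear (\<lambda>q. ?p (snd q))"
      by (rule bounded_clinear_compose[OF bounded_clinear_head_proj bounded_clinear_snd])
    show "bounded_clinear (\<lambda>q. cinner (fst q) (T []) *\<^sub>C T s)"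
      by (rule bounded_clinear_compose[OF bounded_clinear_rank_one bounded_clinear_fst])
    fix q assume "q \<in> (\<lambda>w. (T w, T (w @ s))) ` {w. red w \<and> (w \<noteq> [] \<longrightarrow> side (last w) \<noteq> j)}"
    then obtain w where w: "q = (T w, T (w @ s))" "red w" "w \<noteq> [] \<Longrightarrow> side (last w) \<noteq> j" by blast
    have "red (w @ s)"
      using w(2,3) s by (cases "w = []") (auto simp: reduced_append short_def)
    moreover have "\<not> short j (w @ s)" if w_ne: "w \<noteq> []"
    proof
      assume "short j (w @ s)"
      then obtain z where "w = [z]" "side z = j"
        using w_ne by (auto simp: short_def append_eq_Cons_conv)
      then show False using w(3) by simp
    qed
    ultimately show "?p (snd q) = cinner (fst q) (T []) *\<^sub>C T s"
      using w s by (cases "w = []") (simp_all add: head_proj_T cinner_T_Nil)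
  qed
  then show ?thesis by simp
qed

end

section \<open>The left action of one of the two algebras\<close>

text \<open>A uniform treatment of the cases \<open>emb = Inl\<close>, \<open>\<iota> = I1\<close> and \<open>emb = Inr\<close>, \<open>\<iota> = I2\<close>.\<close>

locale free_factor = free_product \<xi>1 \<xi>2 T
  for \<xi>1 :: "'a::chilbert_space" and \<xi>2 :: "'b::chilbert_space"
    and T :: "('a + 'b) list \<Rightarrow> 'h::chilbert_space" +
  fixes emb :: "'c::chilbert_space \<Rightarrow> 'a + 'b" and \<xi>0 :: 'c and \<iota> :: idx
  assumes norm_xi0: "norm \<xi>0 = 1"
    and letter_cinner_emb: "letter_cinner (emb h) (emb h') = cinner h h'"
    and centred_emb: "centred \<xi>1 \<xi>2 (emb h) \<longleftrightarrow> cinner h \<xi>0 = 0"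
    and side_iff: "side z = \<iota> \<longleftrightarrow> z \<in> range emb"
begin

text \<open>The tensors of these words make up the second factor of the natural unitary
  \<open>\<H> \<cong> \<H>\<^sub>\<iota> \<otimes> \<dots>\<close>.\<close>

definition admissible :: "('a + 'b) list \<Rightarrow> bool"
  where "admissible w \<longleftrightarrow> red w \<and> (w \<noteq> [] \<longrightarrow> side (hd w) \<noteq> \<iota>)"

abbreviation left :: "'c \<Rightarrow> ('a + 'b) list \<Rightarrow> 'h"
  where "left \<equiv> left_tensor T emb \<xi>0"

definition is_rep :: "('c \<Rightarrow> 'c) \<Rightarrow> ('h \<Rightarrow> 'h) \<Rightarrow> bool"
  where "is_rep a L \<longleftrightarrow>
    bounded_clinear L \<and> (\<forall>h w. admissible w \<longrightarrow> L (left h w) = left (a h) w)"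

lemma side_emb [simp]: "side (emb h) = \<iota>"
  by (simp add: side_iff)

lemma cinner_xi0 [simp]: "cinner \<xi>0 \<xi>0 = 1"
  by (simp add: cinner_self norm_xi0)

lemma admissible_Nil [simp]: "admissible []"
  by (simp add: admissible_def)

lemma red_emb_Cons: "red (emb h # w) \<longleftrightarrow> cinner h \<xi>0 = 0 \<and> admissible w"
  by (auto simp: reduced_Cons centred_emb admissible_def)

lemma cinner_centring: "cinner (h - cinner h \<xi>0 *\<^sub>C \<xi>0) \<xi>0 = 0"
  by (simp add: cinner_diff_left cinner_scaleC_left)

lemma T_emb_zero: "admissible w \<Longrightarrow> T (emb 0 # w) = 0"
  using cinner_tensor[of "emb 0 # w" "emb 0 # w"]
  by (simp add: red_emb_Cons letter_cinner_emb)

lemma left_xi0: "admissible w \<Longrightarrow> left \<xi>0 w = T w"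
  using complex_vector.scale_one[of \<xi>0] complex_vector.scale_one[of "T w"]
  by (simp add: left_tensor_def T_emb_zero)

lemma left_centred: "cinner h \<xi>0 = 0 \<Longrightarrow> left h w = T (emb h # w)"
  by (simp add: left_tensor_def)

text \<open>The two shapes are \<open>left \<xi>0 w\<close> and \<open>left h w'\<close>, so every
  simple tensor of a reduced word is a value of \<open>left\<close>.\<close>

lemma red_cases:
  assumes "red w"
  obtains (admissible) "admissible w"
    | (embedded) h w' where "w = emb h # w'" "cinner h \<xi>0 = 0" "admissible w'"
proof (cases "admissible w")
  case False
  then obtain z w' where w: "w = z # w'" "side z = \<iota>"
    using assms by (cases w) (auto simp: admissible_def)
  then obtain h where "z = emb h" using side_iff by blast
  then show thesis using assms w embedded[of h w'] by (simp add: red_emb_Cons)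
qed (rule admissible)

text \<open>This is isometry of the natural identification. The vector \<open>h\<close> splits into
  its part along \<open>\<xi>0\<close> and the centred rest \<open>?c h\<close>; a tensor that
  begins in the \<open>\<iota>\<close>-th space is orthogonal to an admissible one, so the cross
  terms vanish.\<close>

lemma cinner_left:
  assumes w: "admissible w" and w': "admissible w'"
  shows "cinner (left h w) (left h' w') = cinner h h' * cinner (T w) (T w')"
proof -
  let ?c = "\<lambda>h. h - cinner h \<xi>0 *\<^sub>C \<xi>0"
  have red: "red (emb (?c h) # w)" if "admissible w" for h w
    using that by (simp add: red_emb_Cons cinner_centring)
  have "cinner (T w) (T (emb (?c h) # w')) = 0" if "admissible w" "admissible w'" for h w w'
    using that red by (cases w)
      (auto simp: cinner_tensor admissible_def letter_cinner_eq_0)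
  note cross = this[OF w w'] this[OF w' w]
  have cross': "cinner (T (emb (?c h) # w)) (T w') = 0"
    using cross(2) cinner_eq_0_commute by blast
  have "cinner (T (emb (?c h) # w)) (T (emb (?c h') # w')) =
      cinner (?c h) (?c h') * cinner (T w) (T w')"
    using w w' red by (simp add: cinner_tensor letter_cinner_emb admissible_def)
  also have "cinner (?c h) (?c h') = cinner h h' - cinner h \<xi>0 * cnj (cinner h' \<xi>0)"
    using cinner_commute[of \<xi>0 h']
    by (simp add: cinner_diff_left cinner_diff_right cinner_scaleC_left cinner_scaleC_right)
  finally show ?thesis
    unfolding left_tensor_def
    by (simp add: cinner_add_left cinner_add_right cinner_scaleC_left cinner_scaleC_right
        cross cross' algebra_simps)
qed

lemma total_left:
  "closure (complex_vector.span ((\<lambda>(h, w). left h w) ` (UNIV \<times> {w. admissible w}))) = UNIV"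
proof -
  have "T w \<in> (\<lambda>(h, w). left h w) ` (UNIV \<times> {w. admissible w})" if "red w" for w
    using that
  proof (cases rule: red_cases)
    case admissible
    then show ?thesis by (intro image_eqI[of _ _ "(\<xi>0, w)"]) (simp_all add: left_xi0)
  next
    case (embedded h w')
    then show ?thesis by (intro image_eqI[of _ _ "(h, w')"]) (simp_all add: left_centred)
  qed
  then have "closure (complex_vector.span (T ` {w. red w})) \<subseteq>
      closure (complex_vector.span ((\<lambda>(h, w). left h w) ` (UNIV \<times> {w. admissible w})))"
    by (intro closure_mono complex_vector.span_mono) auto
  then show ?thesis by (simp add: total_tensor top.extremum_unique)
qed

section \<open>Existence and uniqueness of \<open>\<lambda>(a)\<close>\<close>

lemma eq_on_left:
  assumes "bounded_clinear f" "bounded_clinear g"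
    and "\<And>h w. admissible w \<Longrightarrow> f (left h w) = g (left h w)"
  shows "f v = g v"
proof (rule bounded_clinear_eq_on_closure_span[OF assms(1,2)])
  show "v \<in> closure (complex_vector.span ((\<lambda>(h, w). left h w) ` (UNIV \<times> {w. admissible w})))"
    by (simp add: total_left)
qed (use assms(3) in auto)

text \<open>Brings squared norms into the form of \<open>tensor_identity_bound\<close>. The function
  \<open>g\<close> will be \<open>a\<close> for the image vector and the identity for the original
  one.\<close>

lemma cinner_left_sum:
  assumes "F \<subseteq> UNIV \<times> {w. admissible w}"
  shows "complex_of_real ((norm (\<Sum>p\<in>F. c p *\<^sub>C left (g (fst p)) (snd p)))\<^sup>2) =
    (\<Sum>p\<in>F. \<Sum>p'\<in>F. cinner (c p *\<^sub>C g (fst p)) (c p' *\<^sub>C g (fst p')) *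
      cinner (T (snd p)) (T (snd p')))"
  unfolding cinner_self[symmetric] cinner_sum_left cinner_sum_right
proof (subst sum.swap, intro sum.cong refl)
  fix p p' assume "p \<in> F" "p' \<in> F"
  then have "admissible (snd p)" "admissible (snd p')" using assms by auto
  then show "cinner (c p *\<^sub>C left (g (fst p)) (snd p)) (c p' *\<^sub>C left (g (fst p')) (snd p')) =
      cinner (c p *\<^sub>C g (fst p)) (c p' *\<^sub>C g (fst p')) * cinner (T (snd p)) (T (snd p'))"
    by (simp add: cinner_scaleC_left cinner_scaleC_right cinner_left)
qed

text \<open>The operator is prescribed on the total set of vectors \<open>left h w\<close>;
  \<open>tensor_identity_bound\<close> with the second factors \<open>T w\<close> makes the
  prescription consistent and bounded by \<open>C\<close>.\<close>

lemma is_rep_exists: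
  assumes a: "bounded_clinear a"
  shows "\<exists>L. is_rep a L"
proof -
  obtain C where C: "C > 0" "\<And>v. norm (a v) \<le> C * norm v"
    using bounded_linear.pos_bounded[OF bounded_clinear_bounded_linear[OF a]]
    by (auto simp: mult.commute)
  have "\<exists>L. bounded_clinear L \<and> (\<forall>p\<in>UNIV \<times> {w. admissible w}.
      L ((\<lambda>(h, w). left h w) p) = left (a (fst p)) (snd p))"
  proof (rule bounded_clinear_extension_family[where C = C, OF total_left])
    fix F :: "('c \<times> ('a + 'b) list) set" and c :: "'c \<times> ('a + 'b) list \<Rightarrow> complex"
    assume F: "finite F" "F \<subseteq> UNIV \<times> {w. admissible w}"
    let ?g = "\<lambda>p. c p *\<^sub>C fst p"
    let ?A = "\<Sum>p\<in>F. c p *\<^sub>C left (a (fst p)) (snd p)"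
    let ?B = "\<Sum>p\<in>F. c p *\<^sub>C left (fst p) (snd p)"
    have A: "(norm ?A)\<^sup>2 = Re (\<Sum>p\<in>F. \<Sum>p'\<in>F.
        cinner (a (?g p)) (a (?g p')) * cinner (T (snd p)) (T (snd p')))"
      using arg_cong[OF cinner_left_sum[OF F(2), of c a], of Re]
      by (simp only: Re_complex_of_real bounded_clinear_scaleC[OF a])
    have B: "(norm ?B)\<^sup>2 = Re (\<Sum>p\<in>F. \<Sum>p'\<in>F.
        cinner (?g p) (?g p') * cinner (T (snd p)) (T (snd p')))"
      using arg_cong[OF cinner_left_sum[OF F(2), of c "\<lambda>h. h"], of Re]
      by (simp only: Re_complex_of_real)
    have "(norm ?A)\<^sup>2 \<le> (C * norm ?B)\<^sup>2"
      using tensor_identity_bound[OF a C(2) F(1), of ?g "\<lambda>p. T (snd p)"]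
      by (simp only: A B power_mult_distrib)
    then have "norm ?A \<le> C * norm ?B"
      by (rule power2_le_imp_le) (use C(1) in simp)
    then show "norm ?A \<le> C * norm (\<Sum>p\<in>F. c p *\<^sub>C (\<lambda>(h, w). left h w) p)"
      by (simp only: case_prod_beta)
  qed
  then show ?thesis by (fastforce simp: is_rep_def)
qed

lemma is_rep_unique:
  assumes "is_rep a L" "is_rep a L'"
  shows "L = L'"
  by (rule ext, rule eq_on_left[of L L']) (use assms in \<open>auto simp: is_rep_def\<close>)

lemma is_rep_free_rep:
  assumes "bounded_clinear a"
  shows "is_rep a (free_rep \<xi>1 \<xi>2 T emb \<xi>0 a)"
proof -
  have "admissible w \<longleftrightarrow> red w \<and> (w \<noteq> [] \<longrightarrow> hd w \<notin> range emb)" for w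
    by (simp add: admissible_def side_iff)
  then have "free_rep \<xi>1 \<xi>2 T emb \<xi>0 a = (THE L. is_rep a L)"
    by (simp only: free_rep_def is_rep_def)
  moreover have "\<exists>!L. is_rep a L"
    using is_rep_exists[OF assms] is_rep_unique by blast
  ultimately show ?thesis using theI' by metis
qed

section \<open>Left action and the last tensor factor\<close>

text \<open>If \<open>T w = left h w'\<close>, then \<open>T (w @ s) = left h (w' @ s)\<close>, and
  \<open>L\<close> replaces \<open>h\<close> by \<open>a h\<close> in both. The premise
  \<open>in_M\<close> covers the two parts of \<open>a h\<close>, along \<open>\<xi>0\<close> and
  centred. The premise \<open>ws\<close> excludes that \<open>w\<close> is empty while
  \<open>s\<close> begins in the \<open>\<iota>\<close>-th space, where \<open>L\<close> would act
  on \<open>s\<close>.\<close>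

lemma is_rep_right_tensor:
  assumes L: "is_rep a L" and M: "complex_vector.subspace M"
    and w: "red w" "red (w @ s)" and ws: "w \<noteq> [] \<or> s = [] \<or> side (hd s) \<noteq> \<iota>"
    and in_M: "\<And>w'. admissible w' \<Longrightarrow> w' = w \<or> (\<exists>h. w = emb h # w') \<Longrightarrow>
      (T w', T (w' @ s)) \<in> M \<and> (\<forall>h. red (emb h # w') \<longrightarrow> (T (emb h # w'), T (emb h # w' @ s)) \<in> M)"
  shows "(L (T w), L (T (w @ s))) \<in> M"
proof -
  obtain h w' where h: "T w = left h w'" "T (w @ s) = left h (w' @ s)" "admissible w'"
      "admissible (w' @ s)" "w' = w \<or> (\<exists>h. w = emb h # w')"
    using w(1)
  proof (cases rule: red_cases)
    case admissible
    then have "admissible (w @ s)"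
      using w(2) ws by (cases w) (auto simp: admissible_def)
    then show ?thesis using that[of \<xi>0 w] admissible by (simp add: left_xi0)
  next
    case (embedded h w')
    show ?thesis
      by (rule that[of h w']) (use embedded w(2) in \<open>auto simp: left_centred red_emb_Cons\<close>)
  qed
  let ?c = "cinner (a h) \<xi>0" and ?h = "a h - cinner (a h) \<xi>0 *\<^sub>C \<xi>0"
  have "(L (T w), L (T (w @ s))) =
      ?c *\<^sub>C (T w', T (w' @ s)) + (T (emb ?h # w'), T (emb ?h # w' @ s))"
    using L h by (simp add: is_rep_def left_tensor_def scaleC_prod_def)
  also have "\<dots> \<in> M"
    using in_M[OF h(3,5)] h(3)
    by (intro complex_vector.subspace_add[OF M] complex_vector.subspace_scale[OF M])
      (simp_all add: red_emb_Cons cinner_centring)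
  finally show ?thesis .
qed

text \<open>Adding, changing or removing a first letter from the \<open>\<iota>\<close>-th space
  cannot produce a last letter from the \<open>j\<close>-th: a word of one new letter ends in the
  \<open>\<iota>\<close>-th space. The application is to \<open>X\<^sub>\<kappa>\<close>, with
  \<open>j\<close> the other index.\<close>

lemma is_rep_right_tensor_other:
  assumes L: "is_rep a L" and j: "j \<noteq> \<iota>" and s: "red s" "short j s"
    and uv: "(u, v) \<in> right_tensor j s"
  shows "(L u, L v) \<in> right_tensor j s"
proof (rule right_tensor_induct[OF uv])
  show "bounded_clinear L" "bounded_clinear L"
    using L by (simp_all add: is_rep_def)
  fix w assume w: "red w" "w \<noteq> [] \<Longrightarrow> side (last w) \<noteq> j"
  show "(L (T w), L (T (w @ s))) \<in> right_tensor j s"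
  proof (rule is_rep_right_tensor[OF L subspace_right_tensor w(1)])
    show "red (w @ s)"
      using w s by (cases "w = []") (auto simp: reduced_append short_def)
    show "w \<noteq> [] \<or> s = [] \<or> side (hd s) \<noteq> \<iota>"
      using s j by (auto simp: short_def)
    fix w' assume w': "admissible w'" "w' = w \<or> (\<exists>h. w = emb h # w')"
    have last: "w' \<noteq> [] \<Longrightarrow> side (last w') \<noteq> j"
      using w'(2) w(2) by auto
    then have "side (last (emb h # w')) \<noteq> j" for h
      using j by (cases "w' = []") auto
    then show "(T w', T (w' @ s)) \<in> right_tensor j s \<and> (\<forall>h. red (emb h # w') \<longrightarrow>
        (T (emb h # w'), T (emb h # w' @ s)) \<in> right_tensor j s)"
      using right_tensorI[of w' j s] right_tensorI[of "emb _ # w'" j s] last w'(1)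
      by (simp add: admissible_def)
  qed
qed

abbreviation p :: "'h \<Rightarrow> 'h"
  where "p \<equiv> head_proj \<iota>"

text \<open>Relative to the first factor, \<open>p\<close> is the identity tensored with the vacuum
  projection. That is why it commutes with \<open>a \<otimes> 1\<close> in
  \<open>is_rep_p_commute\<close>.\<close>

lemma p_left: "admissible w \<Longrightarrow> p (left h w) = (if w = [] then left h w else 0)"
proof -
  assume w: "admissible w"
  let ?h = "h - cinner h \<xi>0 *\<^sub>C \<xi>0"
  have "short \<iota> w \<longleftrightarrow> w = []" "short \<iota> (emb ?h # w) \<longleftrightarrow> w = []"
    using w by (auto simp: short_def admissible_def)
  moreover have "red w" "red (emb ?h # w)"
    using w by (simp_all add: red_emb_Cons cinner_centring admissible_def)
  ultimately show ?thesis
    by (simp add: left_tensor_def bounded_clinear_add[OF bounded_clinear_head_proj]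
        bounded_clinear_scaleC[OF bounded_clinear_head_proj] head_proj_T)
qed

lemma p_idem [simp]: "p (p v) = p v"
  by (rule eq_on_left[OF bounded_clinear_compose[OF bounded_clinear_head_proj
        bounded_clinear_head_proj] bounded_clinear_head_proj])
    (simp add: p_left bounded_clinear_zero[OF bounded_clinear_head_proj])

lemma is_rep_p_commute:
  assumes L: "is_rep a L"
  shows "p (L v) = L (p v)"
proof (rule eq_on_left[of "\<lambda>v. p (L v)" "\<lambda>v. L (p v)"])
  have bL: "bounded_clinear L" using L by (simp add: is_rep_def)
  show "bounded_clinear (\<lambda>v. p (L v))" "bounded_clinear (\<lambda>v. L (p v))"
    by (rule bounded_clinear_compose[OF bounded_clinear_head_proj bL],
        rule bounded_clinear_compose[OF bL bounded_clinear_head_proj])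
  show "p (L (left h w)) = L (p (left h w))" if "admissible w" for h w
    using that L by (simp add: p_left is_rep_def bounded_clinear_zero[OF bL])
qed

text \<open>\<open>L\<close> alone need not respect the relation: for \<open>w = []\<close> and a
  one-letter \<open>s\<close> it would act on \<open>s\<close>. The correction makes
  \<open>R\<close> the identity on the range of \<open>p\<close>, where this case lives; for all
  other generators \<open>p\<close> kills both components, and \<open>R\<close> agrees with
  \<open>L\<close> there.\<close>

lemma is_rep_right_tensor_own:
  assumes L: "is_rep a L" and s: "red s" "short \<iota> s" and uv: "(u, v) \<in> right_tensor \<iota> s"
  defines "R \<equiv> \<lambda>v. L v - (L (p v) - p v)"
  shows "(R u, R v) \<in> right_tensor \<iota> s"
proof (rule right_tensor_induct[OF uv])
  have bL: "bounded_clinear L"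
    using L by (simp add: is_rep_def)
  show "bounded_clinear R" "bounded_clinear R"
    unfolding R_def
    by (rule bounded_clinear_minus[OF bL bounded_clinear_minus[OF bounded_clinear_compose[OF bL
            bounded_clinear_head_proj] bounded_clinear_head_proj]])+
  fix w assume w: "red w" "w \<noteq> [] \<Longrightarrow> side (last w) \<noteq> \<iota>"
  have red: "red (w @ s)"
    using w s by (cases "w = []") (auto simp: reduced_append short_def)
  show "(R (T w), R (T (w @ s))) \<in> right_tensor \<iota> s"
  proof (cases "w = []")
    case True
    then have "R (T w) = T w" "R (T (w @ s)) = T (w @ s)"
      using s by (simp_all add: R_def head_proj_T short_def)
    then show ?thesis using True right_tensorI[of w \<iota> s] by simp
  next
    case False
    have "\<not> short \<iota> (w @ t)" for t
    proof
      assume "short \<iota> (w @ t)"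
      then obtain z where "w = [z]" "side z = \<iota>"
        using False by (auto simp: short_def append_eq_Cons_conv)
      then show False using w(2) by simp
    qed
    from this[of "[]"] this[of s] have "R (T w) = L (T w)" "R (T (w @ s)) = L (T (w @ s))"
      using w(1) red by (simp_all add: R_def head_proj_T bounded_clinear_zero[OF bL])
    moreover have "(L (T w), L (T (w @ s))) \<in> right_tensor \<iota> s"
    proof (rule is_rep_right_tensor[OF L subspace_right_tensor w(1) red])
      fix w' assume w': "admissible w'" "w' = w \<or> (\<exists>h. w = emb h # w')"
      \<comment> \<open>An empty \<open>w'\<close> would make \<open>w\<close> empty or a single
        letter from the \<open>\<iota>\<close>-th space, and both are excluded.\<close>
      have ne: "w' \<noteq> []" using w'(2) w(2) False by auto
      then have last: "side (last w') \<noteq> \<iota>"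
        using w'(2) w(2) by auto
      show "(T w', T (w' @ s)) \<in> right_tensor \<iota> s \<and> (\<forall>h. red (emb h # w') \<longrightarrow>
          (T (emb h # w'), T (emb h # w' @ s)) \<in> right_tensor \<iota> s)"
        using right_tensorI[of w' \<iota> s] right_tensorI[of "emb _ # w'" \<iota> s] last ne w'(1)
        by (simp add: admissible_def)
    qed (use False in simp)
    ultimately show ?thesis by simp
  qed
qed

end

section \<open>The factorization of \<open>X\<^sub>\<kappa> X\<^sub>\<iota>\<close>\<close>

lemma gen_alg_bounded_clinear:
  assumes "w \<in> gen_alg S" and "\<And>a. a \<in> S \<Longrightarrow> bounded_clinear a"
  shows "bounded_clinear w"
  using assms(1)
proof induction
  case (scale a c)
  show ?case by (rule bounded_clinear_compose[OF bounded_clinear_scaled scale.IH])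
next
  case (mult a b)
  show ?case unfolding comp_def by (rule bounded_clinear_compose[OF mult.IH])
qed (use assms(2) in \<open>auto intro: bounded_clinear_const_zero bounded_clinear_plus\<close>)

context free_factor
begin

text \<open>Here \<open>L\<close> is \<open>X\<^sub>\<iota>\<close> and \<open>M\<close> is
  \<open>X\<^sub>\<kappa>\<close>. The assumed compatibility of \<open>M\<close> with
  \<open>right_tensor\<close> will come from \<open>is_rep_right_tensor_other\<close> for the
  opposite factor.\<close>

context
  fixes a L M P X
  assumes L: "is_rep a L" and M: "bounded_clinear M"
    and M_right_tensor: "\<And>s u v. red s \<Longrightarrow> short \<iota> s \<Longrightarrow> (u, v) \<in> right_tensor \<iota> s \<Longrightarrow>
      (M u, M v) \<in> right_tensor \<iota> s"
    and P: "P = block_proj \<xi>1 \<xi>2 T" and X: "X \<iota> = L" "X (bar \<iota>) = M"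
begin

lemma bounded_L: "bounded_clinear L"
  using L by (simp add: is_rep_def)

lemma bounded_p: "bounded_clinear p"
  by (rule bounded_clinear_head_proj)

lemma bounded_Lp: "bounded_clinear (\<lambda>v. L (p v))"
  by (rule bounded_clinear_compose[OF bounded_L bounded_p])

lemma block_diff_eq: "block_diff P X \<iota> 1 = (\<lambda>v. L (p v) - p v)"
proof -
  have "P \<iota> 1 = p" by (simp only: P head_proj_def)
  then show ?thesis
    by (simp only: block_diff_def block_part_def X comp_def is_rep_p_commute[OF L] p_idem)
qed

lemma op_q_eq: "op_q P X \<iota> = (\<lambda>v. v + (L (p v) - p v))"
  by (simp only: op_q_def block_diff_eq)

lemma op_Q_eq: "op_Q P X (bar \<iota>) = (\<lambda>v. M (L v - (L (p v) - p v)))"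
  by (simp only: op_Q_def bar_bar X block_diff_eq comp_def)

text \<open>On the range of \<open>p\<close> the outer operator is the identity and
  \<open>op_q\<close> acts as \<open>L\<close>; on the kernel of \<open>p\<close> it is the other
  way round.\<close>

lemma complement_op_q: "L (op_q P X \<iota> v) - (L (p (op_q P X \<iota> v)) - p (op_q P X \<iota> v)) = L v"
  by (simp add: op_q_eq bounded_clinear_add[OF bounded_L] bounded_clinear_diff[OF bounded_L]
      bounded_clinear_add[OF bounded_p] bounded_clinear_diff[OF bounded_p] is_rep_p_commute[OF L])

lemma factorization: "X (bar \<iota>) \<circ> X \<iota> = op_Q P X (bar \<iota>) \<circ> op_q P X \<iota>"
  by (simp only: op_Q_eq X fun_eq_iff comp_def complement_op_q simp_thms)

lemma bounded_complement: "bounded_clinear (\<lambda>v. L v - (L (p v) - p v))"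
  by (rule bounded_clinear_minus[OF bounded_L bounded_clinear_minus[OF bounded_Lp bounded_p]])

lemma bounded_q_minus: "bounded_clinear (\<lambda>v. op_q P X \<iota> v - v)"
  unfolding op_q_eq by (simp add: bounded_clinear_minus[OF bounded_Lp bounded_p])

lemma bounded_Q_minus: "bounded_clinear (\<lambda>v. op_Q P X (bar \<iota>) v - v)"
  unfolding op_Q_eq
  by (rule bounded_clinear_minus[OF bounded_clinear_compose[OF M bounded_complement]
        bounded_clinear_id])

section \<open>The two generated algebras and monotone independence\<close>

lemma gen_alg_q_corner:
  assumes "b \<in> gen_alg {\<lambda>v. op_q P X \<iota> v - v}"
  shows "p (b v) = b v \<and> b (p v) = b v"
  using assms
proof (induction arbitrary: v)
  case zero
  then show ?case by (simp add: bounded_clinear_zero[OF bounded_p])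
next
  case (gen b)
  then show ?case
    by (simp add: op_q_eq bounded_clinear_diff[OF bounded_p] is_rep_p_commute[OF L])
next
  case (add b c)
  then show ?case by (simp add: bounded_clinear_add[OF bounded_p])
next
  case (scale b c)
  then show ?case by (simp add: bounded_clinear_scaleC[OF bounded_p])
qed simp

text \<open>Operators respecting a linear relation form an algebra, so only the generator matters:
  \<open>is_rep_right_tensor_own\<close> treats its inner factor and \<open>M_right_tensor\<close>
  the outer one.\<close>

lemma gen_alg_Q_right_tensor:
  assumes "b \<in> gen_alg {\<lambda>v. op_Q P X (bar \<iota>) v - v}" and s: "red s" "short \<iota> s"
    and "(u, v) \<in> right_tensor \<iota> s"
  shows "(b u, b v) \<in> right_tensor \<iota> s"
  using assms(1,4)
proof (induction arbitrary: u v)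
  case zero
  then show ?case
    using complex_vector.subspace_0[OF subspace_right_tensor[of \<iota> s]] by (simp add: zero_prod_def)
next
  case (gen b)
  have "(M (L u - (L (p u) - p u)), M (L v - (L (p v) - p v))) \<in> right_tensor \<iota> s"
    by (intro M_right_tensor s is_rep_right_tensor_own[OF L s] gen.prems)
  from complex_vector.subspace_diff[OF subspace_right_tensor this gen.prems] gen.hyps
  show ?case by (simp add: op_Q_eq)
next
  case (add b c)
  from complex_vector.subspace_add[OF subspace_right_tensor add.IH[OF add.prems]]
  show ?case by simp
next
  case (scale b c)
  from complex_vector.subspace_scale[OF subspace_right_tensor scale.IH[OF scale.prems], of c]
  show ?case by (simp add: scaleC_prod_def)
qed simp

text \<open>A short \<open>T w\<close> is the vacuum tensored with \<open>T w\<close> as last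
  factor. There \<open>b\<close> acts on the vacuum alone, and \<open>p\<close> keeps the vacuum
  coefficient of \<open>b (T [])\<close>, which is the state of \<open>b\<close>. All other simple
  tensors are killed by \<open>p\<close>.\<close>

lemma gen_alg_Q_compression:
  assumes b: "b \<in> gen_alg {\<lambda>v. op_Q P X (bar \<iota>) v - v}"
  shows "p (b (p v)) = vector_state (T []) b *\<^sub>C p v"
proof -
  have bounded: "bounded_clinear b"
    using gen_alg_bounded_clinear[OF b] bounded_Q_minus by simp
  show ?thesis
  proof (rule bounded_clinear_eq_on_closure_span[OF _ _ _ closure_span_tensors,
        of "\<lambda>v. p (b (p v))" "\<lambda>v. vector_state (T []) b *\<^sub>C p v"])
    show "bounded_clinear (\<lambda>v. p (b (p v)))"
      by (rule bounded_clinear_compose[OF bounded_p bounded_clinear_compose[OF bounded bounded_p]])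
    show "bounded_clinear (\<lambda>v. vector_state (T []) b *\<^sub>C p v)"
      by (rule bounded_clinear_compose[OF bounded_clinear_scaled bounded_p])
    fix t assume "t \<in> T ` {w. red w}"
    then obtain w where w: "red w" "t = T w" by blast
    show "p (b (p t)) = vector_state (T []) b *\<^sub>C p t"
    proof (cases "short \<iota> w")
      case True
      have "(T [], T w) \<in> right_tensor \<iota> w"
        using right_tensorI[of "[]" \<iota> w] by simp
      from head_proj_right_tensor[OF gen_alg_Q_right_tensor[OF b w(1) True this] w(1) True]
      show ?thesis using w True by (simp add: head_proj_T vector_state_def)
    next
      case False
      then show ?thesis
        using w by (simp add: head_proj_T bounded_clinear_zero[OF bounded_p]
            bounded_clinear_zero[OF bounded])
    qed
  qed
qed

lemma monotone_independent_q_Q: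
  "monotone_independent (vector_state (T [])) (\<lambda>v. op_q P X \<iota> v - v)
    (\<lambda>v. op_Q P X (bar \<iota>) v - v)"
proof -
  let ?A = "gen_alg {\<lambda>v. op_q P X \<iota> v - v}" and ?B = "gen_alg {\<lambda>v. op_Q P X (bar \<iota>) v - v}"
  let ?W = "gen_alg (insert id (?A \<union> ?B))" and ?\<phi> = "vector_state (T [])"
  have A: "bounded_clinear a1" if "a1 \<in> ?A" for a1
    using gen_alg_bounded_clinear[OF that] bounded_q_minus by simp
  have B: "bounded_clinear b" if "b \<in> ?B" for b
    using gen_alg_bounded_clinear[OF that] bounded_Q_minus by simp
  have W: "bounded_clinear w" if "w \<in> ?W" for w
    using gen_alg_bounded_clinear[OF that] A B bounded_clinear_id by (auto simp: id_def)
  have p_vac: "p (T []) = T []"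
    by (simp add: head_proj_T short_def)
  \<comment> \<open>Elements of \<open>?A\<close> absorb \<open>p\<close> on their right, so
    \<open>b\<close> is compressed as soon as \<open>v\<close> is fixed by \<open>p\<close>. This
    holds for the vacuum and for all vectors in the range of \<open>a2\<close>.\<close>
  have left: "a1 (b v) = ?\<phi> b *\<^sub>C a1 v" if "a1 \<in> ?A" "b \<in> ?B" "p v = v" for a1 b v
  proof -
    have "a1 (b v) = a1 (p (b (p v)))"
      using gen_alg_q_corner[OF that(1), of "b v"] that(3) by simp
    also have "\<dots> = ?\<phi> b *\<^sub>C a1 v"
      unfolding gen_alg_Q_compression[OF that(2)]
      by (simp only: that(3) bounded_clinear_scaleC[OF A[OF that(1)]])
    finally show ?thesis .
  qed
  \<comment> \<open>Here the vacuum in the second argument supplies the outer \<open>p\<close>,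
    moved across by self-adjointness.\<close>
  have right: "cinner (b v) (T []) = ?\<phi> b * cinner v (T [])" if "b \<in> ?B" "p v = v" for b v
  proof -
    have "cinner (b v) (T []) = cinner (p (b (p v))) (T [])"
      by (simp only: head_proj_self_adjoint p_vac that(2))
    then show ?thesis
      unfolding gen_alg_Q_compression[OF that(1)] by (simp only: that(2) cinner_scaleC_left)
  qed
  show ?thesis
    unfolding monotone_independent_def
  proof (intro ballI conjI)
    fix a1 a2 b w1 w2
    assume *: "a1 \<in> ?A" "a2 \<in> ?A" "b \<in> ?B" "w1 \<in> ?W" "w2 \<in> ?W"
    have fix2: "p (a2 v) = a2 v" for v
      using gen_alg_q_corner[OF *(2)] by simp
    show "?\<phi> (w1 \<circ> a1 \<circ> b) = ?\<phi> b * ?\<phi> (w1 \<circ> a1)"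
      unfolding vector_state_def[of _ "w1 \<circ> _"] vector_state_def[of _ "w1 \<circ> _ \<circ> _"]
      by (simp only: comp_apply left[OF *(1,3) p_vac] bounded_clinear_scaleC[OF W[OF *(4)]]
          cinner_scaleC_left)
    show "?\<phi> (b \<circ> a2 \<circ> w2) = ?\<phi> b * ?\<phi> (a2 \<circ> w2)"
      unfolding vector_state_def[of _ "_ \<circ> w2"]
      by (simp only: comp_apply right[OF *(3) fix2])
    show "?\<phi> (w1 \<circ> a1 \<circ> b \<circ> a2 \<circ> w2) = ?\<phi> b * ?\<phi> (w1 \<circ> a1 \<circ> a2 \<circ> w2)"
      unfolding vector_state_def[of _ "_ \<circ> w2"]
      by (simp only: comp_apply left[OF *(1,3) fix2] bounded_clinear_scaleC[OF W[OF *(4)]]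
          cinner_scaleC_left)
  qed
qed

text \<open>Since \<open>p\<close> commutes with \<open>L\<close>, it commutes with the inverse
  \<open>g\<close>. Thus \<open>op_q\<close> is \<open>L\<close> on the range of \<open>p\<close>
  and the identity on the complement, and \<open>q'\<close>, built from \<open>g\<close> in the same
  way, is its adjoint and inverse.\<close>

lemma unitary_q_Q:
  assumes "unitary_op L" "unitary_op M"
  shows "unitary_op (op_q P X \<iota>)" and "unitary_op (op_Q P X (bar \<iota>))"
proof -
  obtain g where g: "is_adjoint L g" "g \<circ> L = id" "L \<circ> g = id"
    using assms(1) unfolding unitary_op_def by blast
  have gL [simp]: "g (L v) = v" and Lg [simp]: "L (g v) = v" for v
    using g(2,3) by (simp_all add: fun_eq_iff)
  have bg: "bounded_clinear g"
    by (rule is_adjoint_bounded_clinear[OF g(1,3)])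
  have pg: "p (g v) = g (p v)" for v
    using arg_cong[OF is_rep_p_commute[OF L, of "g v"], of g] by simp
  define q' where "q' = (\<lambda>v. v + (g (p v) - p v))"
  note linear = bounded_clinear_add[OF bounded_L] bounded_clinear_diff[OF bounded_L]
    bounded_clinear_add[OF bounded_p] bounded_clinear_diff[OF bounded_p]
    bounded_clinear_add[OF bg] bounded_clinear_diff[OF bg]
  have adj: "is_adjoint (op_q P X \<iota>) q'"
    unfolding is_adjoint_def
  proof (intro allI)
    fix u v
    have "cinner (L (p u)) v = cinner u (g (p v))"
      using g(1) by (simp add: is_adjoint_def head_proj_self_adjoint pg)
    then show "cinner (op_q P X \<iota> u) v = cinner u (q' v)"
      by (simp add: op_q_eq q'_def cinner_add_left cinner_add_right cinner_diff_left
          cinner_diff_right head_proj_self_adjoint)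
  qed
  have inv: "q' \<circ> op_q P X \<iota> = id" "op_q P X \<iota> \<circ> q' = id"
    by (simp_all add: fun_eq_iff op_q_eq q'_def linear pg is_rep_p_commute[OF L])
  have "bounded_clinear (op_q P X \<iota>)"
    unfolding op_q_eq
    by (rule bounded_clinear_plus[OF bounded_clinear_id bounded_clinear_minus[OF bounded_Lp bounded_p]])
  then show "unitary_op (op_q P X \<iota>)"
    unfolding unitary_op_def using adj inv by blast
  have "unitary_op q'"
    by (rule unitary_op_inverse[OF adj inv])
  \<comment> \<open>Evaluating \<open>complement_op_q\<close> at \<open>q' v\<close> gives
    \<open>L (q' v)\<close> for the inner factor, so the operator is a product of three
    unitaries.\<close>
  moreover have "op_Q P X (bar \<iota>) = (\<lambda>v. M (L (q' v)))"
  proof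
    fix v
    have "op_q P X \<iota> (q' v) = v" using inv(2) by (simp add: fun_eq_iff)
    then show "op_Q P X (bar \<iota>) v = M (L (q' v))"
      using complement_op_q[of "q' v"] by (simp only: op_Q_eq)
  qed
  ultimately show "unitary_op (op_Q P X (bar \<iota>))"
    using unitary_op_compose[OF assms(2) unitary_op_compose[OF assms(1)]] by simp
qed

end

end

theorem theorem7p2:
  fixes \<xi>1 :: "'a::chilbert_space" and \<xi>2 :: "'b::chilbert_space"
    and T :: "('a + 'b) list \<Rightarrow> 'h::chilbert_space"
    and x :: "'a \<Rightarrow> 'a" and y :: "'b \<Rightarrow> 'b"
    and \<phi> :: "('h \<Rightarrow> 'h) \<Rightarrow> complex"
    and P :: "idx \<Rightarrow> nat \<Rightarrow> 'h \<Rightarrow> 'h"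
    and X q Q :: "idx \<Rightarrow> 'h \<Rightarrow> 'h"
  assumes "free_product \<xi>1 \<xi>2 T"
    and "bounded_clinear x" and "bounded_clinear y"
    and phi: "\<phi> = vector_state (T [])"
    and P: "P = block_proj \<xi>1 \<xi>2 T"
    and X: "X = free_pair \<xi>1 \<xi>2 T x y"
    and q: "q = op_q P X"
    and Q: "Q = op_Q P X"
  shows "(\<forall>\<iota>. distribution \<phi> (X (bar \<iota>) \<circ> X \<iota>) = distribution \<phi> (Q (bar \<iota>) \<circ> q \<iota>) \<and>
              monotone_independent \<phi> (\<lambda>v. q \<iota> v - v) (\<lambda>v. Q (bar \<iota>) v - v)) \<and>
         ((\<forall>\<iota>. unitary_op (X \<iota>)) \<longrightarrow> (\<forall>\<iota>. unitary_op (q \<iota>) \<and> unitary_op (Q \<iota>)))"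
proof -
  interpret free_product \<xi>1 \<xi>2 T by fact
  have side: "side z = I1 \<longleftrightarrow> z \<in> range Inl" "side z = I2 \<longleftrightarrow> z \<in> range Inr" for z :: "'a + 'b"
    by (cases z; auto)+
  interpret F1: free_factor \<xi>1 \<xi>2 T Inl \<xi>1 I1
    by unfold_locales (simp_all add: norm_xi1 side)
  interpret F2: free_factor \<xi>1 \<xi>2 T Inr \<xi>2 I2
    by unfold_locales (simp_all add: norm_xi2 side)
  have X1: "F1.is_rep x (X I1)" and X2: "F2.is_rep y (X I2)"
    using F1.is_rep_free_rep F2.is_rep_free_rep assms(2,3) by (simp_all add: X)
  have bounded: "bounded_clinear (X I1)" "bounded_clinear (X I2)"
    using X1 X2 by (simp_all add: F1.is_rep_def F2.is_rep_def)
  have right1: "(X I1 u, X I1 v) \<in> right_tensor I2 s"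
    if "red s" "short I2 s" "(u, v) \<in> right_tensor I2 s" for u v s
    using F1.is_rep_right_tensor_other[OF X1 _ that] by simp
  have right2: "(X I2 u, X I2 v) \<in> right_tensor I1 s"
    if "red s" "short I1 s" "(u, v) \<in> right_tensor I1 s" for u v s
    using F2.is_rep_right_tensor_other[OF X2 _ that] by simp
  have bar: "X (bar I1) = X I2" "X (bar I2) = X I1" by simp_all
  \<comment> \<open>For each index its own operator plays \<open>L\<close> and the opposite one
    plays \<open>M\<close>.\<close>
  note hyps1 = X1 bounded(2) right2 P refl bar(1)
  note hyps2 = X2 bounded(1) right1 P refl bar(2)
  \<comment> \<open>The factorization is an equality of operators, hence of all moments.\<close>
  have "distribution \<phi> (X (bar \<iota>) \<circ> X \<iota>) = distribution \<phi> (Q (bar \<iota>) \<circ> q \<iota>)" for \<iota>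
    by (cases \<iota>)
      (simp_all only: q Q F1.factorization[OF hyps1] F2.factorization[OF hyps2])
  moreover have "monotone_independent \<phi> (\<lambda>v. q \<iota> v - v) (\<lambda>v. Q (bar \<iota>) v - v)" for \<iota>
    using F1.monotone_independent_q_Q[OF hyps1] F2.monotone_independent_q_Q[OF hyps2]
    by (cases \<iota>) (simp_all only: q Q phi)
  \<comment> \<open>\<open>q \<iota>\<close> is covered by the factor of \<open>\<iota>\<close>, but
    \<open>Q \<iota>\<close> by that of \<open>bar \<iota>\<close>.\<close>
  moreover have "unitary_op (q \<iota>) \<and> unitary_op (Q \<iota>)" if "\<forall>\<iota>. unitary_op (X \<iota>)" for \<iota>
    using F1.unitary_q_Q[OF hyps1] F2.unitary_q_Q[OF hyps2] that
    by (cases \<iota>) (simp_all add: q Q)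
  ultimately show ?thesis by blast
qed

end
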